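(* Let $L$ be an $n$-dimensional nilpotent Lie algebra with $\dim L^2=m$, where $m\geq 1$. Then \[\dim \mathcal{M}^{(2)}(L)\leq \tfrac13(n-m)\big((n+2m-2)(n-m-1)+3(m-1)\big)+3.\] In particular, $\dim\mathcal{M}^{(2)}(L)\leq \frac13 n(n-1)(n-2)+3$, and equality holds in this last inequality if and only if $L\cong H(1)\oplus A(n-3)$.
   Context: All Lie algebras are over a fixed field. For a Lie algebra $L$ with free presentation $L\cong F/R$, the $2$-nilpotent multiplier is $\mathcal{M}^{(2)}(L)=(R\cap F^{3})/[[R,F],F]$, where $F^3=[[F,F],F]$. $A(k)$ denotes the abelian Lie algebra of dimension $k$, and $H(1)$ is the $3$-dimensional Heisenberg Lie algebra (dimension $3$, $H(1)^2=Z(H(1))$, $\dim H(1)^2=1$). *)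

theory Defs
  imports Complex_Main "HOL-Library.Extended_Nat" "HOL-Library.Function_Algebras"
begin

definition lie_alg :: "('k::field \<Rightarrow> 'v::ab_group_add \<Rightarrow> 'v) \<Rightarrow> 'v set \<Rightarrow> ('v \<Rightarrow> 'v \<Rightarrow> 'v) \<Rightarrow> bool" where
  "lie_alg sc C br \<longleftrightarrow>
     vector_space sc \<and> module.subspace sc C \<and>
     (\<forall>x\<in>C. \<forall>y\<in>C. br x y \<in> C) \<and>
     (\<forall>x\<in>C. \<forall>y\<in>C. \<forall>z\<in>C. br (x + y) z = br x z + br y z \<and> br x (y + z) = br x y + br x z) \<and>
     (\<forall>a. \<forall>x\<in>C. \<forall>y\<in>C. br (sc a x) y = sc a (br x y) \<and> br x (sc a y) = sc a (br x y)) \<and>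
     (\<forall>x\<in>C. br x x = 0) \<and>
     (\<forall>x\<in>C. \<forall>y\<in>C. \<forall>z\<in>C. br x (br y z) + br y (br z x) + br z (br x y) = 0)"

definition lie_brk :: "('k::field \<Rightarrow> 'v::ab_group_add \<Rightarrow> 'v) \<Rightarrow> ('v \<Rightarrow> 'v \<Rightarrow> 'v) \<Rightarrow> 'v set \<Rightarrow> 'v set \<Rightarrow> 'v set" where
  "lie_brk sc br A B = module.span sc {br a b | a b. a \<in> A \<and> b \<in> B}"

text \<open>Lower central series: lie_pow sc br C k is L^(k+1); so L^1 = L, L^2 = [L,L], L^3 = [[L,L],L].\<close>
fun lie_pow :: "('k::field \<Rightarrow> 'v::ab_group_add \<Rightarrow> 'v) \<Rightarrow> ('v \<Rightarrow> 'v \<Rightarrow> 'v) \<Rightarrow> 'v set \<Rightarrow> nat \<Rightarrow> 'v set" where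
  "lie_pow sc br C 0 = C"
| "lie_pow sc br C (Suc k) = lie_brk sc br (lie_pow sc br C k) C"

definition lie_nilpotent :: "('k::field \<Rightarrow> 'v::ab_group_add \<Rightarrow> 'v) \<Rightarrow> 'v set \<Rightarrow> ('v \<Rightarrow> 'v \<Rightarrow> 'v) \<Rightarrow> bool" where
  "lie_nilpotent sc C br \<longleftrightarrow> (\<exists>k. lie_pow sc br C k = {0})"

definition fin_dim :: "('k::field \<Rightarrow> 'v::ab_group_add \<Rightarrow> 'v) \<Rightarrow> 'v set \<Rightarrow> bool" where
  "fin_dim sc C \<longleftrightarrow> (\<exists>B. finite B \<and> C \<subseteq> module.span sc B)"

definition lie_hom ::
  "('k::field \<Rightarrow> 'v::ab_group_add \<Rightarrow> 'v) \<Rightarrow> ('v \<Rightarrow> 'v \<Rightarrow> 'v) \<Rightarrow> 'v set \<Rightarrow>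
   ('k \<Rightarrow> 'w::ab_group_add \<Rightarrow> 'w) \<Rightarrow> ('w \<Rightarrow> 'w \<Rightarrow> 'w) \<Rightarrow> 'w set \<Rightarrow> ('v \<Rightarrow> 'w) \<Rightarrow> bool" where
  "lie_hom sc1 br1 C1 sc2 br2 C2 f \<longleftrightarrow>
     f ` C1 \<subseteq> C2 \<and>
     (\<forall>x\<in>C1. \<forall>y\<in>C1. f (x + y) = f x + f y \<and> f (br1 x y) = br2 (f x) (f y)) \<and>
     (\<forall>a. \<forall>x\<in>C1. f (sc1 a x) = sc2 a (f x))"

definition lie_iso ::
  "('k::field \<Rightarrow> 'v::ab_group_add \<Rightarrow> 'v) \<Rightarrow> ('v \<Rightarrow> 'v \<Rightarrow> 'v) \<Rightarrow> 'v set \<Rightarrow>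
   ('k \<Rightarrow> 'w::ab_group_add \<Rightarrow> 'w) \<Rightarrow> ('w \<Rightarrow> 'w \<Rightarrow> 'w) \<Rightarrow> 'w set \<Rightarrow> ('v \<Rightarrow> 'w) \<Rightarrow> bool" where
  "lie_iso sc1 br1 C1 sc2 br2 C2 f \<longleftrightarrow> lie_hom sc1 br1 C1 sc2 br2 C2 f \<and> bij_betw f C1 C2"

text \<open>F (carrier in type 'v) is a free Lie algebra on X \<subseteq> F: every map from X into a Lie
algebra extends uniquely to a Lie homomorphism.  The targets range over Lie algebras carried by
subspaces of the same ambient space; since the ambient space contains F, it is large enough to
contain a copy of every Lie algebra generated by |X| elements, so this is equivalent to the usual
universal property.\<close>
definition free_lie_on :: "('k::field \<Rightarrow> 'v::ab_group_add \<Rightarrow> 'v) \<Rightarrow> ('v \<Rightarrow> 'v \<Rightarrow> 'v) \<Rightarrow> 'v set \<Rightarrow> 'v set \<Rightarrow> bool" where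
  "free_lie_on sc br F X \<longleftrightarrow> lie_alg sc F br \<and> X \<subseteq> F \<and>
     (\<forall>M brM \<phi>. lie_alg sc M brM \<and> \<phi> ` X \<subseteq> M \<longrightarrow>
        (\<exists>\<psi>. lie_hom sc br F sc brM M \<psi> \<and> (\<forall>x\<in>X. \<psi> x = \<phi> x)) \<and>
        (\<forall>\<psi>1 \<psi>2. lie_hom sc br F sc brM M \<psi>1 \<and> lie_hom sc br F sc brM M \<psi>2 \<and>
            (\<forall>x\<in>X. \<psi>1 x = \<phi> x) \<and> (\<forall>x\<in>X. \<psi>2 x = \<phi> x) \<longrightarrow> (\<forall>y\<in>F. \<psi>1 y = \<psi>2 y)))"

definition quot_dim :: "('k::field \<Rightarrow> 'v::ab_group_add \<Rightarrow> 'v) \<Rightarrow> 'v set \<Rightarrow> 'v set \<Rightarrow> enat" where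
  "quot_dim sc U W =
     (if \<exists>S. finite S \<and> S \<subseteq> U \<and> U \<subseteq> module.span sc (S \<union> W)
      then enat (LEAST d. \<exists>S. finite S \<and> card S = d \<and> S \<subseteq> U \<and> U \<subseteq> module.span sc (S \<union> W))
      else \<infinity>)"

text \<open>2-nilpotent multiplier of L = F/R: dim (R \<inter> F^3) / [[R,F],F].\<close>
definition mult2_dim :: "('k::field \<Rightarrow> 'v::ab_group_add \<Rightarrow> 'v) \<Rightarrow> ('v \<Rightarrow> 'v \<Rightarrow> 'v) \<Rightarrow> 'v set \<Rightarrow> 'v set \<Rightarrow> enat" where
  "mult2_dim sc br F R = quot_dim sc (R \<inter> lie_pow sc br F 2) (lie_brk sc br (lie_brk sc br R F) F)"

text \<open>Concrete model of H(1) \<oplus> A(n-3) (n \<ge> 3): vectors v :: nat \<Rightarrow> 'k supported on {0..<n},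
basis e_0,...,e_{n-1}, only nonzero bracket [e_0,e_1] = e_2.\<close>
definition hA_car :: "nat \<Rightarrow> (nat \<Rightarrow> 'k::field) set" where
  "hA_car n = {v. \<forall>i\<ge>n. v i = 0}"

definition hA_scale :: "'k::field \<Rightarrow> (nat \<Rightarrow> 'k) \<Rightarrow> (nat \<Rightarrow> 'k)" where
  "hA_scale c v = (\<lambda>i. c * v i)"

definition hA_br :: "(nat \<Rightarrow> 'k::field) \<Rightarrow> (nat \<Rightarrow> 'k) \<Rightarrow> (nat \<Rightarrow> 'k)" where
  "hA_br x y = (\<lambda>i. if i = 2 then x 0 * y 1 - x 1 * y 0 else 0)"

definition iso_H1_plus_A :: "('k::field \<Rightarrow> 'v::ab_group_add \<Rightarrow> 'v) \<Rightarrow> ('v \<Rightarrow> 'v \<Rightarrow> 'v) \<Rightarrow> 'v set \<Rightarrow> nat \<Rightarrow> bool" where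
  "iso_H1_plus_A sc br L n \<longleftrightarrow> 3 \<le> n \<and>
     (\<exists>f. lie_iso sc br L (hA_scale :: 'k \<Rightarrow> _) hA_br (hA_car n) f)"

end

theory Submission
  imports Defs
begin

text \<open>Write \<open>E = F / [[R,F],F]\<close>. Since \<open>[[R,F],F] = 0\<close> in \<open>E\<close>, the triple bracket of \<open>E\<close>
  descends to a trilinear map \<open>\<tau>\<close> on \<open>L\<close>, and \<open>(R \<inter> F\<^sup>3) / [[R,F],F]\<close> embeds into the span of the
  values of \<open>\<tau>\<close>. Let \<open>c = n - m\<close> be the dimension of \<open>L / L\<^sup>2\<close>. Modulo the values \<open>\<tau>(L\<^sup>2,L,L)\<close> there
  remain the \<open>(c\<^sup>3 - c)/3\<close> Hall triple brackets in \<open>c\<close> generators. Filtering \<open>L\<^sup>2\<close> by ideals of \<open>L\<close> with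
  one-dimensional central factors, each factor contributes at most \<open>c\<^sup>2\<close>, because \<open>\<tau>(s,x,y)\<close> depends,
  modulo the lower part, only on \<open>x\<close> and \<open>y\<close> modulo \<open>L\<^sup>2\<close>. For the top factor, spanned by \<open>s = [x,y]\<close>,
  the Jacobi identity leaves only \<open>\<tau>(s,x,x)\<close>, \<open>\<tau>(s,x,y)\<close> and \<open>\<tau>(s,y,y)\<close>.

  The total is strictly below the bound for \<open>m = 1\<close> unless \<open>m = 1\<close>, and then the top factor contributes
  only if the commutator form on \<open>L / L\<^sup>2\<close> has rank two, which forces \<open>L\<close> to be \<open>H(1) \<oplus> A(n - 3)\<close>.
  Conversely, for that algebra the Hall triples and three brackets of length four stay independent:
  homomorphisms from \<open>F\<close> to strictly upper triangular 5 by 5 matrices lifting \<open>F \<rightarrow> L\<close> provide the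
  functionals that read off coefficients of suitable words.\<close>

section \<open>Quotient dimensions and Lie algebras on a carrier\<close>

context vector_space
begin

lemma extend_to_finite_basis:
  assumes "finite T" "V \<subseteq> span T" "B \<subseteq> V" "independent B"
  obtains C where "B \<subseteq> C" "C \<subseteq> V" "independent C" "V \<subseteq> span C" "finite C" "card C = dim V"
proof -
  obtain C where C: "B \<subseteq> C" "C \<subseteq> V" "independent C" "V \<subseteq> span C"
    using maximal_independent_subset_extend[OF assms(3,4)] by metis
  have "finite C"
    using independent_span_bound[OF assms(1) C(3)] C(2) assms(2) by blast
  moreover have "card C = dim V"
    by (rule basis_card_eq_dim[OF C(2,4,3)])
  ultimately show thesis using that C by blast
qed

lemma independent_family:
  assumes fin: "finite I"
    and ind: "\<And>a. (\<Sum>i\<in>I. scale (a i) (v i)) = 0 \<Longrightarrow> \<forall>i\<in>I. a i = 0"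
  shows "inj_on v I" "independent (v ` I)"
proof -
  show inj: "inj_on v I"
  proof (rule inj_onI, rule ccontr)
    fix i j assume ij: "i \<in> I" "j \<in> I" "v i = v j" "i \<noteq> j"
    let ?a = "\<lambda>k. if k = i then 1 else if k = j then - 1 else 0 :: 'a"
    have "(\<Sum>k\<in>I. scale (?a k) (v k)) = (\<Sum>k\<in>{i,j}. scale (?a k) (v k))"
      by (rule sum.mono_neutral_right) (use fin ij in auto)
    also have "\<dots> = 0" using ij by simp
    finally have "\<forall>k\<in>I. ?a k = 0" using ind[of ?a] by blast
    then show False using ij(1) by auto
  qed
  show "independent (v ` I)"
  proof (rule independent_if_scalars_zero)
    show "finite (v ` I)" using fin by simp
    fix f x assume f: "(\<Sum>x\<in>v ` I. scale (f x) x) = 0" and x: "x \<in> v ` I"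
    have "(\<Sum>i\<in>I. scale (f (v i)) (v i)) = 0"
      using f by (simp add: sum.reindex[OF inj])
    then have "\<forall>i\<in>I. f (v i) = 0" by (rule ind)
    then show "f x = 0" using x by auto
  qed
qed

lemma card_le_dim_family:
  assumes "finite T" "V \<subseteq> span T" "finite I" "v ` I \<subseteq> V"
    and "\<And>a. (\<Sum>i\<in>I. scale (a i) (v i)) = 0 \<Longrightarrow> \<forall>i\<in>I. a i = 0"
  shows "card I \<le> dim V"
proof -
  note * = independent_family[OF assms(3), of v, OF assms(5)]
  obtain C where C: "v ` I \<subseteq> C" "finite C" "card C = dim V"
    using extend_to_finite_basis[OF assms(1,2,4) *(2)] by metis
  have "card I = card (v ` I)" using *(1) by (simp add: card_image)
  also have "\<dots> \<le> card C" by (rule card_mono[OF C(2,1)])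
  finally show ?thesis using C by simp
qed

text \<open>The quotient map by \<open>W\<close> is realised as an endomorphism: extend a basis of
  \<open>W\<close> to a basis of the whole space, send the basis of \<open>W\<close> to 0 and fix
  the other basis vectors. Quotients can then be studied as images under \<open>p\<close>.\<close>

lemma kernel_projection:
  assumes W: "subspace W"
  obtains p where "Vector_Spaces.linear scale scale p" "\<And>x. p x = 0 \<longleftrightarrow> x \<in> W"
proof -
  obtain B0 where B0: "B0 \<subseteq> W" "independent B0" "W \<subseteq> span B0"
    using maximal_independent_subset by blast
  obtain B where B: "B0 \<subseteq> B" "independent B" "UNIV \<subseteq> span B"
    using maximal_independent_subset_extend[OF subset_UNIV B0(2)] by metis
  interpret vector_space_pair scale scale ..
  define p where "p = construct B (\<lambda>b. if b \<in> B0 then 0 else b)"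
  have lin: "Vector_Spaces.linear scale scale p"
    unfolding p_def by (rule linear_construct[OF B(2)])
  interpret p: Vector_Spaces.linear scale scale p by (rule lin)
  have p0: "p x = 0" if "x \<in> span B0" for x
    using that
  proof (rule p.eq_0_on_span[rotated])
    fix x assume "x \<in> B0" then show "p x = 0"
      unfolding p_def using construct_basis[OF B(2)] B(1) by auto
  qed
  have p1: "p x = x" if "x \<in> span (B - B0)" for x
  proof -
    have "p x = id x"
    proof (rule linear_eq_on_span[OF lin _ _ that])
      show "Vector_Spaces.linear scale scale id" using linear_id by blast
      fix b assume "b \<in> B - B0" then show "p b = id b"
        unfolding p_def using construct_basis[OF B(2)] by auto
    qed
    then show ?thesis by simp
  qed
  have "p x = 0 \<longleftrightarrow> x \<in> W" for x
  proof
    assume "x \<in> W" then show "p x = 0" using p0 B0(3) by blast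
  next
    assume px: "p x = 0"
    have "x \<in> span (B0 \<union> (B - B0))" using B by (auto simp: Un_absorb1)
    then obtain u w where uw: "x = u + w" "u \<in> span B0" "w \<in> span (B - B0)"
      unfolding span_Un by blast
    then have "w = 0" using px p0 p1 by (simp add: p.add)
    then show "x \<in> W" using uw span_minimal[OF B0(1) W] by auto
  qed
  then show thesis using that lin by blast
qed

text \<open>Turns the least cardinality in \<open>quot_dim\<close> into an ordinary dimension. A
  basis of the image of \<open>U\<close> lifts to a set that spans \<open>U\<close> modulo
  \<open>W\<close>; conversely the image of any such set spans the image of \<open>U\<close>, so it
  cannot be smaller.\<close>

lemma quot_dim_eq_dim_image:
  assumes lin: "Vector_Spaces.linear scale scale p" and ker: "\<And>x. p x = 0 \<longleftrightarrow> x \<in> W"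
    and T: "finite T" "p ` U \<subseteq> span T"
  shows "quot_dim scale U W = enat (dim (p ` U))"
proof -
  interpret p: Vector_Spaces.linear scale scale p by (rule lin)
  let ?P = "\<lambda>d S. finite S \<and> card S = d \<and> S \<subseteq> U \<and> U \<subseteq> span (S \<union> W)"
  obtain B where B: "B \<subseteq> p ` U" "independent B" "p ` U \<subseteq> span B" "finite B" "card B = dim (p ` U)"
    using extend_to_finite_basis[OF T, of "{}"] by (metis empty_subsetI independent_empty)
  obtain S where S: "S \<subseteq> U" "inj_on p S" "B = p ` S"
    using B(1) by (metis subset_image_inj)
  have finS: "finite S" using S B(4) by (simp add: finite_image_iff)
  have cardS: "card S = dim (p ` U)" using S B(5) by (simp add: card_image)
  have "U \<subseteq> span (S \<union> W)"
  proof
    fix u assume "u \<in> U"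
    then have "p u \<in> p ` span S" using B(3) S(3) p.span_image by auto
    then obtain t where t: "t \<in> span S" "p u = p t" by auto
    then have "u - t \<in> W" using ker[of "u - t"] by (simp add: p.diff)
    then have "u - t \<in> span (S \<union> W)" "t \<in> span (S \<union> W)"
      using t(1) span_mono[of S "S \<union> W"] by (auto intro: span_base)
    then show "u \<in> span (S \<union> W)" by (metis diff_add_cancel span_add)
  qed
  then have ex: "?P (dim (p ` U)) S" using finS cardS S(1) by blast
  have min: "dim (p ` U) \<le> d" if "?P d S'" for d S'
  proof -
    have "p ` U \<subseteq> p ` span (S' \<union> W)" using that by blast
    also have "\<dots> = span (p ` (S' \<union> W))" by (rule p.span_image[symmetric])
    also have "\<dots> \<subseteq> span (insert 0 (p ` S'))"
      by (rule span_mono) (use ker in auto)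
    also have "\<dots> = span (p ` S')" by simp
    finally have "dim (p ` U) \<le> card (p ` S')"
      using dim_le_card that by blast
    then show ?thesis using that card_image_le[of S' p] by linarith
  qed
  have "(LEAST d. \<exists>S. ?P d S) = dim (p ` U)"
    by (rule Least_equality) (use ex min in blast)+
  moreover have "\<exists>S. finite S \<and> S \<subseteq> U \<and> U \<subseteq> span (S \<union> W)" using ex by blast
  ultimately show ?thesis unfolding quot_dim_def by simp
qed

text \<open>Supplies room in the ambient space of a free Lie algebra for a copy of any
  finite-dimensional coordinate space.\<close>

lemma infinite_dimensional_independent:
  assumes "\<And>T. finite T \<Longrightarrow> span T \<noteq> UNIV"
  obtains B where "finite B" "card B = N" "independent B"
proof -
  obtain B where B: "independent B" "UNIV \<subseteq> span B"
    using maximal_independent_subset[of UNIV] by metis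
  then have "infinite B" using assms by blast
  then obtain C where "finite C" "card C = N" "C \<subseteq> B"
    using infinite_arbitrarily_large by blast
  then show thesis using that B independent_mono by blast
qed

end

section \<open>Lie algebras carried by a subspace\<close>

locale lie_algebra =
  fixes s :: "'k::field \<Rightarrow> 'v::ab_group_add \<Rightarrow> 'v" and C :: "'v set" and br :: "'v \<Rightarrow> 'v \<Rightarrow> 'v"
  assumes lie: "lie_alg s C br"
begin

sublocale vector_space s
  using lie by (simp add: lie_alg_def)

lemma C_subspace: "subspace C"
  using lie by (simp add: lie_alg_def)

lemmas C_0 [simp] = subspace_0[OF C_subspace]
lemmas C_add [simp] = subspace_add[OF C_subspace]
lemmas C_diff [simp] = subspace_diff[OF C_subspace]
lemmas C_neg [simp] = subspace_neg[OF C_subspace]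
lemmas C_scale [simp] = subspace_scale[OF C_subspace]

lemma br_closed [simp]: "x \<in> C \<Longrightarrow> y \<in> C \<Longrightarrow> br x y \<in> C"
  using lie by (simp add: lie_alg_def)

lemma br_add_left: "x \<in> C \<Longrightarrow> y \<in> C \<Longrightarrow> z \<in> C \<Longrightarrow> br (x + y) z = br x z + br y z"
  and br_add_right: "x \<in> C \<Longrightarrow> y \<in> C \<Longrightarrow> z \<in> C \<Longrightarrow> br x (y + z) = br x y + br x z"
  and br_scale_left: "x \<in> C \<Longrightarrow> y \<in> C \<Longrightarrow> br (s a x) y = s a (br x y)"
  and br_scale_right: "x \<in> C \<Longrightarrow> y \<in> C \<Longrightarrow> br x (s a y) = s a (br x y)"
  and br_self [simp]: "x \<in> C \<Longrightarrow> br x x = 0"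
  and jacobi: "x \<in> C \<Longrightarrow> y \<in> C \<Longrightarrow> z \<in> C \<Longrightarrow> br x (br y z) + br y (br z x) + br z (br x y) = 0"
  using lie unfolding lie_alg_def by blast+

lemma br_antisym: "x \<in> C \<Longrightarrow> y \<in> C \<Longrightarrow> br y x = - br x y"
  using br_self[of "x + y"] br_add_left[of x y "x + y"] br_add_right[of x x y] br_add_right[of y x y]
  by (simp add: eq_neg_iff_add_eq_0 add.commute)

lemma br_0_left [simp]: "x \<in> C \<Longrightarrow> br 0 x = 0"
  using br_scale_left[of 0 x 0] by simp

lemma br_0_right [simp]: "x \<in> C \<Longrightarrow> br x 0 = 0"
  using br_scale_right[of x 0 0] by simp

lemma br_neg_left: "x \<in> C \<Longrightarrow> y \<in> C \<Longrightarrow> br (- x) y = - br x y"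
  using br_scale_left[of x y "- 1"] by simp

lemma br_neg_right: "x \<in> C \<Longrightarrow> y \<in> C \<Longrightarrow> br x (- y) = - br x y"
  using br_scale_right[of x y "- 1"] by simp

lemma br_diff_left: "x \<in> C \<Longrightarrow> y \<in> C \<Longrightarrow> z \<in> C \<Longrightarrow> br (x - y) z = br x z - br y z"
  using br_add_left[of x "- y" z] by (simp add: br_neg_left)

lemma br_diff_right: "x \<in> C \<Longrightarrow> y \<in> C \<Longrightarrow> z \<in> C \<Longrightarrow> br x (y - z) = br x y - br x z"
  using br_add_right[of x y "- z"] by (simp add: br_neg_right)

text \<open>The Jacobi identity in the form that rewrites right-nested brackets into left-normed
  ones.\<close>

lemma br_br_right:
  assumes "x \<in> C" "y \<in> C" "z \<in> C"
  shows "br x (br y z) = br (br x y) z - br (br x z) y"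
  using jacobi[OF assms] assms br_antisym[of "br x y" z] br_antisym[of "br x z" y] br_antisym[of x z]
  by (simp add: br_neg_right eq_neg_iff_add_eq_0 algebra_simps)

lemma lie_brk_subspace: "subspace (lie_brk s br A B)"
  by (simp add: lie_brk_def)

lemma lie_brkI: "a \<in> A \<Longrightarrow> b \<in> B \<Longrightarrow> br a b \<in> lie_brk s br A B"
  unfolding lie_brk_def by (rule span_base) blast

lemma lie_brk_least:
  assumes "subspace S" "\<And>a b. a \<in> A \<Longrightarrow> b \<in> B \<Longrightarrow> br a b \<in> S"
  shows "lie_brk s br A B \<subseteq> S"
  unfolding lie_brk_def by (rule span_minimal) (use assms in auto)

lemma lie_brk_mono: "A \<subseteq> A' \<Longrightarrow> B \<subseteq> B' \<Longrightarrow> lie_brk s br A B \<subseteq> lie_brk s br A' B'"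
  by (rule lie_brk_least[OF lie_brk_subspace]) (auto intro: lie_brkI)

lemma lie_brk_subset_C: "A \<subseteq> C \<Longrightarrow> B \<subseteq> C \<Longrightarrow> lie_brk s br A B \<subseteq> C"
  by (rule lie_brk_least[OF C_subspace]) (blast intro: br_closed)

end

section \<open>Alternating triple brackets\<close>

context lie_algebra
begin

text \<open>For a nonzero ideal \<open>K\<close> of a nilpotent algebra, \<open>[K, C]\<close> is
  proper in \<open>K\<close>. Extending a basis of it to a basis of \<open>K\<close> and dropping
  one new vector \<open>v\<close> leaves a hyperplane \<open>K'\<close> that contains
  \<open>[K, C]\<close>; hence \<open>K'\<close> is again an ideal and \<open>v\<close> is central
  modulo \<open>K'\<close>.\<close>

lemma ideal_hyperplane:
  assumes fd: "fin_dim s C" and nil: "lie_nilpotent s C br"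
    and K: "subspace K" "K \<subseteq> C" "lie_brk s br K C \<subseteq> K" "dim K = Suc k"
  obtains v K' where "v \<in> K" "v \<notin> K'" "subspace K'" "K' \<subseteq> K" "lie_brk s br K C \<subseteq> K'" "dim K' = k"
    "\<And>x. x \<in> K \<Longrightarrow> \<exists>a. x - s a v \<in> K'"
proof -
  let ?D = "lie_brk s br K C"
  obtain T where T: "finite T" "C \<subseteq> span T" using fd unfolding fin_dim_def by blast
  have "?D \<noteq> K"
  proof
    assume D: "?D = K"
    \<comment> \<open>\<open>K = [K, C]\<close> would put \<open>K\<close> into every term of the
      lower central series, and so into 0.\<close>
    have sub: "K \<subseteq> lie_pow s br C j" for j
      by (induction j) (use K(2) D lie_brk_mono[of K _ C C] in auto)
    obtain j where "lie_pow s br C j = {0}" using nil unfolding lie_nilpotent_def by blast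
    then have "K \<subseteq> span {}" using sub[of j] by simp
    then have "dim K \<le> 0" using dim_le_card[of K "{}"] by simp
    then show False using K(4) by simp
  qed
  obtain B where B: "B \<subseteq> ?D" "independent B" "?D \<subseteq> span B"
    using maximal_independent_subset by blast
  have "K \<subseteq> span T" "B \<subseteq> K" using T(2) K(2,3) B(1) by blast+
  then obtain E where E: "B \<subseteq> E" "E \<subseteq> K" "independent E" "K \<subseteq> span E" "finite E" "card E = dim K"
    using extend_to_finite_basis[OF T(1) _ _ B(2)] by metis
  have "E \<noteq> B"
  proof
    assume "E = B"
    then have "K \<subseteq> ?D" using E(4) span_minimal[OF B(1) lie_brk_subspace] by blast
    then show False using \<open>?D \<noteq> K\<close> K(3) by blast
  qed
  then obtain v where v: "v \<in> E" "v \<notin> B" using E(1) by blast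
  let ?K' = "span (E - {v})"
  have ind: "independent (E - {v})" using E(3) independent_mono by blast
  show thesis
  proof
    show "v \<in> K" using v E by blast
    show "v \<notin> ?K'" using E(3) v(1) unfolding dependent_def by blast
    show "subspace ?K'" by simp
    show "?K' \<subseteq> K" by (rule span_minimal[OF _ K(1)]) (use E in blast)
    show "?D \<subseteq> ?K'" using B(3) span_mono[of B "E - {v}"] E(1) v(2) by blast
    show "dim ?K' = k" using dim_span_eq_card_independent[OF ind] E(5,6) v(1) K(4) by simp
    fix x assume "x \<in> K"
    then have "x \<in> span (insert v (E - {v}))" using E(4) v(1) by (simp add: insert_absorb subsetD)
    then show "\<exists>a. x - s a v \<in> ?K'" by (simp only: span_breakdown_eq)
  qed
qed

end

section \<open>Trilinear maps that satisfy the identities of the triple bracket\<close>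

text \<open>The axioms record what \<open>[[x, y], z]\<close> satisfies when \<open>x\<close>,
  \<open>y\<close>, \<open>z\<close> are lifted to an extension in which the value does not depend
  on the lifts. \<open>br2\<close> and \<open>br3\<close> are the Jacobi identity with a bracket as
  second or third argument, and \<open>br_diag\<close> is
  \<open>[[x, y], [x, y]] = 0\<close>.\<close>

locale triple_bracket = lie_algebra s C br + V: vector_space sv
  for s :: "'k::field \<Rightarrow> 'v::ab_group_add \<Rightarrow> 'v" and C br
    and sv :: "'k \<Rightarrow> 'w::ab_group_add \<Rightarrow> 'w" +
  fixes \<tau> :: "'v \<Rightarrow> 'v \<Rightarrow> 'v \<Rightarrow> 'w"
  assumes add1: "\<lbrakk>x \<in> C; x' \<in> C; y \<in> C; z \<in> C\<rbrakk> \<Longrightarrow> \<tau> (x + x') y z = \<tau> x y z + \<tau> x' y z"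
    and scale1: "\<lbrakk>x \<in> C; y \<in> C; z \<in> C\<rbrakk> \<Longrightarrow> \<tau> (s a x) y z = sv a (\<tau> x y z)"
    and add3: "\<lbrakk>x \<in> C; y \<in> C; z \<in> C; z' \<in> C\<rbrakk> \<Longrightarrow> \<tau> x y (z + z') = \<tau> x y z + \<tau> x y z'"
    and scale3: "\<lbrakk>x \<in> C; y \<in> C; z \<in> C\<rbrakk> \<Longrightarrow> \<tau> x y (s a z) = sv a (\<tau> x y z)"
    and anti: "\<lbrakk>x \<in> C; y \<in> C; z \<in> C\<rbrakk> \<Longrightarrow> \<tau> y x z = - \<tau> x y z"
    and alt: "\<lbrakk>x \<in> C; z \<in> C\<rbrakk> \<Longrightarrow> \<tau> x x z = 0"
    and cyc: "\<lbrakk>x \<in> C; y \<in> C; z \<in> C\<rbrakk> \<Longrightarrow> \<tau> x y z + \<tau> y z x + \<tau> z x y = 0"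
    and br2: "\<lbrakk>x \<in> C; y \<in> C; z \<in> C; w \<in> C\<rbrakk> \<Longrightarrow> \<tau> x (br y z) w = \<tau> (br x y) z w - \<tau> (br x z) y w"
    and br3: "\<lbrakk>x \<in> C; y \<in> C; z \<in> C; w \<in> C\<rbrakk> \<Longrightarrow> \<tau> x y (br z w) = \<tau> (br x y) z w - \<tau> (br x y) w z"
    and br_diag: "\<lbrakk>x \<in> C; y \<in> C\<rbrakk> \<Longrightarrow> \<tau> x y (br x y) = 0"
begin

lemma add2: "\<lbrakk>x \<in> C; y \<in> C; y' \<in> C; z \<in> C\<rbrakk> \<Longrightarrow> \<tau> x (y + y') z = \<tau> x y z + \<tau> x y' z"
  using anti[of "y + y'" x z] anti[of y x z] anti[of y' x z] add1[of y y' x z] by simp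

lemma scale2: "\<lbrakk>x \<in> C; y \<in> C; z \<in> C\<rbrakk> \<Longrightarrow> \<tau> x (s a y) z = sv a (\<tau> x y z)"
  using anti[of "s a y" x z] anti[of y x z] scale1[of y x z a] by simp

definition linear_on_C :: "('v \<Rightarrow> 'w) \<Rightarrow> bool" where
  "linear_on_C g \<longleftrightarrow> (\<forall>x\<in>C. \<forall>y\<in>C. g (x + y) = g x + g y) \<and> (\<forall>a. \<forall>x\<in>C. g (s a x) = sv a (g x))"

lemma linear_slots:
  assumes "x \<in> C" "y \<in> C"
  shows "linear_on_C (\<lambda>u. \<tau> u x y)" "linear_on_C (\<lambda>u. \<tau> x u y)" "linear_on_C (\<lambda>u. \<tau> x y u)"
  using assms unfolding linear_on_C_def by (simp_all add: add1 add2 add3 scale1 scale2 scale3)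

lemma linear_on_C_span:
  assumes g: "linear_on_C g" and A: "A \<subseteq> C" and S: "V.subspace S"
    and im: "\<And>x. x \<in> A \<Longrightarrow> g x \<in> S" and x: "x \<in> span A"
  shows "g x \<in> S"
proof -
  have g0: "g 0 = 0"
    using g[unfolded linear_on_C_def, THEN conjunct2, rule_format, of 0 0] by simp
  have "subspace {x \<in> C. g x \<in> S}"
    using g S by (intro subspaceI) (auto simp: linear_on_C_def g0 V.subspace_0 V.subspace_add V.subspace_scale)
  then have "span A \<subseteq> {x \<in> C. g x \<in> S}"
    by (rule span_minimal[rotated]) (use A im in auto)
  then show ?thesis using x by blast
qed

text \<open>Restricting the first slot is enough: by \<open>anti\<close> and \<open>J_slot3\<close>,
  an argument from \<open>K\<close> in the second or third slot also gives a value in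
  \<open>J K\<close>.\<close>

definition J :: "'v set \<Rightarrow> 'w set" where
  "J K = V.span {\<tau> k x y | k x y. k \<in> K \<and> x \<in> C \<and> y \<in> C}"

lemma JI: "k \<in> K \<Longrightarrow> x \<in> C \<Longrightarrow> y \<in> C \<Longrightarrow> \<tau> k x y \<in> J K"
  unfolding J_def by (rule V.span_base) blast

lemma J_least:
  assumes "V.subspace S" "\<And>k x y. \<lbrakk>k \<in> K; x \<in> C; y \<in> C\<rbrakk> \<Longrightarrow> \<tau> k x y \<in> S"
  shows "J K \<subseteq> S"
  unfolding J_def by (rule V.span_minimal) (use assms in auto)

lemma J_subspace: "V.subspace (J K)"
  by (simp add: J_def)

abbreviation "C2 \<equiv> lie_brk s br C C"

lemma C2_C: "C2 \<subseteq> C"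
  by (rule lie_brk_subset_C) auto

lemma linear_on_C_C2:
  assumes "linear_on_C g" "V.subspace S" "\<And>x y. x \<in> C \<Longrightarrow> y \<in> C \<Longrightarrow> g (br x y) \<in> S" "x \<in> C2"
  shows "g x \<in> S"
  by (rule linear_on_C_span[OF assms(1) _ assms(2)]) (use assms(3,4) in \<open>auto simp: lie_brk_def\<close>)

text \<open>By \<open>br2\<close>, a bracket \<open>[a, b]\<close> in the second slot can be traded
  for \<open>[v, a]\<close> and \<open>[v, b]\<close> in the first. Together with
  \<open>slot3_C2\<close> this makes \<open>\<tau> v\<close>, modulo \<open>J K\<close>, a bilinear
  map on \<open>C\<close> modulo \<open>C2\<close>.\<close>

lemma slot2_C2:
  assumes "v \<in> C" "\<And>x. x \<in> C \<Longrightarrow> br v x \<in> K" "x \<in> C2" "y \<in> C"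
  shows "\<tau> v x y \<in> J K"
proof (rule linear_on_C_C2[OF _ J_subspace _ assms(3)])
  show "linear_on_C (\<lambda>x. \<tau> v x y)" using linear_slots assms by blast
  fix a b assume ab: "a \<in> C" "b \<in> C"
  then show "\<tau> v (br a b) y \<in> J K"
    using assms by (simp add: br2 V.subspace_diff[OF J_subspace] JI)
qed

lemma slot3_C2:
  assumes "v \<in> C" "\<And>x. x \<in> C \<Longrightarrow> br v x \<in> K" "x \<in> C" "y \<in> C2"
  shows "\<tau> v x y \<in> J K"
proof (rule linear_on_C_C2[OF _ J_subspace _ assms(4)])
  show "linear_on_C (\<lambda>y. \<tau> v x y)" using linear_slots assms by blast
  fix a b assume ab: "a \<in> C" "b \<in> C"
  then show "\<tau> v x (br a b) \<in> J K"
    using assms by (simp add: br3 V.subspace_diff[OF J_subspace] JI)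
qed

text \<open>The cyclic identity moves \<open>k\<close> from the third slot to the other two, and
  \<open>anti\<close> brings it to the first.\<close>

lemma J_slot3:
  assumes "K \<subseteq> C" "k \<in> K" "x \<in> C" "y \<in> C"
  shows "\<tau> x y k \<in> J K"
proof -
  have k: "k \<in> C" using assms by blast
  have "\<tau> x y k = \<tau> k y x - \<tau> k x y"
    using cyc[of x y k] anti[of k y x] assms k by (simp add: algebra_simps eq_neg_iff_add_eq_0)
  then show ?thesis using assms by (simp add: V.subspace_diff[OF J_subspace] JI)
qed

end

text \<open>The elements \<open>a i\<close> with \<open>i < c\<close> span \<open>C\<close> modulo
  its derived algebra; in the application \<open>c = n - m\<close>.\<close>

locale triple_bracket_nilpotent = triple_bracket +
  fixes a :: "nat \<Rightarrow> 'b" and c :: nat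
  assumes fd: "fin_dim s C" and nil: "lie_nilpotent s C br"
    and a_C: "\<And>i. i < c \<Longrightarrow> a i \<in> C"
    and decomp: "\<And>x. x \<in> C \<Longrightarrow> \<exists>u \<in> span (a ` {..<c}). \<exists>w \<in> C2. x = u + w"
begin

lemma a_sub: "a ` {..<c} \<subseteq> C"
  using a_C by blast

lemma span_a_C: "span (a ` {..<c}) \<subseteq> C"
  by (rule span_minimal[OF a_sub C_subspace])

text \<open>Since \<open>[v, C]\<close> lies in \<open>K'\<close>, modulo \<open>J K'\<close> only
  the classes of \<open>x\<close> and \<open>y\<close> modulo \<open>C2\<close> matter, so the
  \<open>c\<^sup>2\<close> values on pairs \<open>a i\<close>, \<open>a j\<close> suffice.\<close>

lemma step_span:
  assumes v: "v \<in> K" "K \<subseteq> C" "lie_brk s br K C \<subseteq> K'" and xy: "x \<in> C" "y \<in> C"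
    and S: "V.subspace S" "J K' \<subseteq> S" "\<And>i j. i < c \<Longrightarrow> j < c \<Longrightarrow> \<tau> v (a i) (a j) \<in> S"
  shows "\<tau> v x y \<in> S"
proof -
  have vC: "v \<in> C" using v by blast
  have bv: "br v z \<in> K'" if "z \<in> C" for z using that v lie_brkI by blast
  obtain x1 x2 where x: "x1 \<in> span (a ` {..<c})" "x2 \<in> C2" "x = x1 + x2" using decomp[OF xy(1)] by blast
  obtain y1 y2 where y: "y1 \<in> span (a ` {..<c})" "y2 \<in> C2" "y = y1 + y2" using decomp[OF xy(2)] by blast
  have inC: "x1 \<in> C" "x2 \<in> C" "y1 \<in> C" "y2 \<in> C" using x y span_a_C C2_C by blast+
  have 1: "\<tau> v x1 (a j) \<in> S" if "j < c" for j
    by (rule linear_on_C_span[OF linear_slots(2)[OF vC a_C[OF that]] a_sub S(1) _ x(1)]) (use S(3) that in auto)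
  have 2: "\<tau> v x1 y1 \<in> S"
    by (rule linear_on_C_span[OF linear_slots(3)[OF vC inC(1)] a_sub S(1) _ y(1)]) (use 1 in auto)
  have "\<tau> v x2 y \<in> S" "\<tau> v x1 y2 \<in> S"
    using slot2_C2[OF vC bv x(2) xy(2)] slot3_C2[OF vC bv inC(1) y(2)] S(2) by blast+
  moreover have "\<tau> v x y = \<tau> v x1 y1 + \<tau> v x1 y2 + \<tau> v x2 y"
    using inC vC xy by (simp add: x(3) add2 y(3) add3)
  ultimately show ?thesis using 2 S(1) by (simp add: V.subspace_add)
qed

lemma J_extend:
  assumes K: "K \<subseteq> C" "K' \<subseteq> K" and v: "v \<in> K" "\<And>x. x \<in> K \<Longrightarrow> \<exists>\<alpha>. x - s \<alpha> v \<in> K'"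
    and S: "V.subspace S" "J K' \<subseteq> S" "\<And>x y. x \<in> C \<Longrightarrow> y \<in> C \<Longrightarrow> \<tau> v x y \<in> S"
  shows "J K \<subseteq> S"
proof (rule J_least[OF S(1)])
  fix k x y assume k: "k \<in> K" and xy: "x \<in> C" "y \<in> C"
  obtain \<alpha> where \<alpha>: "k - s \<alpha> v \<in> K'" using v(2) k by blast
  have C: "k \<in> C" "v \<in> C" using k v K by auto
  have "\<tau> k x y = \<tau> (k - s \<alpha> v) x y + sv \<alpha> (\<tau> v x y)"
    using add1[of "k - s \<alpha> v" "s \<alpha> v" x y] scale1[of v x y \<alpha>] C xy by simp
  then show "\<tau> k x y \<in> S"
    using S JI[OF \<alpha> xy] xy by (auto intro!: V.subspace_add V.subspace_scale)
qed

text \<open>Induction along a chain of ideals, each a hyperplane in the next: by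
  \<open>step_span\<close> every dimension of \<open>K\<close> costs at most
  \<open>c\<^sup>2\<close> new values.\<close>

lemma J_bound:
  assumes "subspace K" "K \<subseteq> C" "lie_brk s br K C \<subseteq> K" "dim K = k"
  shows "\<exists>T. finite T \<and> card T \<le> k * c\<^sup>2 \<and> J K \<subseteq> V.span T"
  using assms
proof (induction k arbitrary: K)
  case 0
  obtain T where T: "finite T" "C \<subseteq> span T" using fd unfolding fin_dim_def by blast
  then have "K \<subseteq> span T" using 0 by blast
  then obtain B where "finite B" "card B = dim K" "K \<subseteq> span B"
    using extend_to_finite_basis[OF T(1), of K "{}"] by (metis empty_subsetI independent_empty)
  then have "K \<subseteq> {0}" using 0 by simp
  then have "J K \<subseteq> V.span {}"
    by (intro J_least) (use scale1[of 0 _ _ 0] in auto)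
  then show ?case by (intro exI[of _ "{}"]) auto
next
  case (Suc k)
  obtain v K' where v: "v \<in> K" "v \<notin> K'" "subspace K'" "K' \<subseteq> K" "lie_brk s br K C \<subseteq> K'" "dim K' = k"
    "\<And>x. x \<in> K \<Longrightarrow> \<exists>a. x - s a v \<in> K'"
    using ideal_hyperplane[OF fd nil Suc.prems] by metis
  \<comment> \<open>\<open>K'\<close> is again an ideal because it contains all of
    \<open>[K, C]\<close>.\<close>
  have "lie_brk s br K' C \<subseteq> K'" using lie_brk_mono[OF v(4), of C C] v(5) by blast
  then obtain T where T: "finite T" "card T \<le> k * c\<^sup>2" "J K' \<subseteq> V.span T"
    using Suc.IH[OF v(3) _ _ v(6)] v(4) Suc.prems(2) by blast
  let ?N = "(\<lambda>(i, j). \<tau> v (a i) (a j)) ` ({..<c} \<times> {..<c})"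
  have "card ?N \<le> card ({..<c} \<times> {..<c})" by (rule card_image_le) simp
  then have cN: "card ?N \<le> c\<^sup>2" by (simp add: power2_eq_square)
  have sub: "V.span T \<subseteq> V.span (T \<union> ?N)" by (rule V.span_mono) blast
  have "\<tau> v x y \<in> V.span (T \<union> ?N)" if "x \<in> C" "y \<in> C" for x y
    by (rule step_span[OF v(1) Suc.prems(2) v(5) that]) (use T(3) sub in \<open>auto intro!: V.span_base\<close>)
  then have "J K \<subseteq> V.span (T \<union> ?N)"
    by (intro J_extend[OF Suc.prems(2) v(4,1,7)]) (use T(3) sub in auto)
  moreover have "card (T \<union> ?N) \<le> Suc k * c\<^sup>2"
    using card_Un_le[of T ?N] T(2) cN by simp
  ultimately show ?case using T(1) by (intro exI[of _ "T \<union> ?N"]) auto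
qed

end

section \<open>Counting Hall triples\<close>

text \<open>Indices of the basic commutators \<open>[[a i, a j], a k]\<close> of weight three, which
  form a basis of the degree three part of a free Lie algebra on \<open>c\<close>
  generators.\<close>

definition hall_triples :: "nat \<Rightarrow> (nat \<times> nat \<times> nat) set" where
  "hall_triples c = {(i, j, k). j < i \<and> j \<le> k \<and> i < c \<and> k < c}"

lemma finite_hall_triples [simp]: "finite (hall_triples c)"
  by (rule finite_subset[of _ "{..<c} \<times> {..<c} \<times> {..<c}"]) (auto simp: hall_triples_def)

text \<open>For each \<open>j\<close> there are \<open>c - 1 - j\<close> choices of \<open>i\<close>
  and \<open>c - j\<close> choices of \<open>k\<close>. The additive form avoids subtraction and
  division of naturals.\<close>

lemma card_hall_triples: "3 * card (hall_triples c) + c = c ^ 3"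
proof -
  have "bij_betw (\<lambda>(j, i, k). (i, j, k)) (SIGMA j:{..<c}. {j<..<c} \<times> {j..<c}) (hall_triples c)"
    by (rule bij_betw_byWitness[where f' = "\<lambda>(i, j, k). (j, i, k)"]) (auto simp: hall_triples_def)
  then have "card (hall_triples c) = (\<Sum>j<c. (c - Suc j) * (c - j))"
    by (simp add: bij_betw_same_card[symmetric])
  also have "3 * \<dots> + c = c ^ 3"
  proof (induction c)
    case (Suc c)
    have "(\<Sum>j<Suc c. (Suc c - Suc j) * (Suc c - j)) = c * Suc c + (\<Sum>j<c. (c - Suc j) * (c - j))"
      by (subst sum.lessThan_Suc_shift) simp
    then show ?case using Suc by (simp add: power3_eq_cube algebra_simps)
  qed simp
  finally show ?thesis .
qed

section \<open>Recognising H(1) + A(n - 3)\<close>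

context lie_algebra
begin

text \<open>The common centraliser \<open>?Z\<close> of \<open>x\<close> and \<open>y\<close> is
  abelian by \<open>orth\<close> and contains the central element \<open>v\<close>, and
  \<open>C\<close> is the direct sum of \<open>?Z\<close> and the plane of \<open>x\<close> and
  \<open>y\<close>. A basis starting with \<open>x\<close>, \<open>y\<close>, \<open>v\<close> and
  completed inside \<open>?Z\<close> has the multiplication table of the model.\<close>

lemma iso_H1_plus_A_criterion:
  assumes fd: "fin_dim s C" and xy: "x \<in> C" "y \<in> C" and v: "v = br x y" "v \<noteq> 0"
    and multiples: "\<And>u w. u \<in> C \<Longrightarrow> w \<in> C \<Longrightarrow> \<exists>\<alpha>. br u w = s \<alpha> v"
    and central: "\<And>u. u \<in> C \<Longrightarrow> br v u = 0"
    and orth: "\<And>u w. \<lbrakk>u \<in> C; w \<in> C; br x u = 0; br y u = 0; br x w = 0; br y w = 0\<rbrakk> \<Longrightarrow> br u w = 0"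
  shows "iso_H1_plus_A s br C (dim C)"
proof -
  let ?Z = "{z \<in> C. br x z = 0 \<and> br y z = 0}"
  have vC: "v \<in> C" using v xy by simp
  have Z: "subspace ?Z"
    by (rule subspaceI) (use xy in \<open>auto simp: br_add_right br_scale_right\<close>)
  have vZ: "v \<in> ?Z"
    using central[OF xy(1)] central[OF xy(2)] br_antisym[OF vC xy(1)] br_antisym[OF vC xy(2)] vC by simp
  have yx: "br y x = - v" using br_antisym[OF xy] v by simp
  obtain T where T: "finite T" "C \<subseteq> span T" using fd unfolding fin_dim_def by blast
  have "?Z \<subseteq> span T" using T(2) by blast
  moreover have "{v} \<subseteq> ?Z" using vZ by blast
  moreover have "independent {v}" using v(2) dependent_single by blast
  ultimately obtain B where B: "{v} \<subseteq> B" "B \<subseteq> ?Z" "independent B" "?Z \<subseteq> span B" "finite B"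
    by (rule extend_to_finite_basis[OF T(1)])
  have BZ: "span B \<subseteq> ?Z" by (rule span_minimal[OF B(2) Z])
  have y_notin: "y \<notin> span B" using BZ v by auto
  have x_notin: "x \<notin> span (insert y B)"
  proof
    assume "x \<in> span (insert y B)"
    then obtain k where "x - s k y \<in> span B" unfolding span_breakdown_eq ..
    then have "br y (x - s k y) = 0" using BZ by blast
    then show False using xy yx v(2) by (simp add: br_diff_right br_scale_right)
  qed
  let ?E = "insert x (insert y B)"
  have indE: "independent ?E" by (intro independent_insertI B(3) x_notin y_notin)
  have "x \<notin> insert y B" "y \<notin> B" using x_notin y_notin by (auto intro: span_base)
  have decomp: "\<exists>\<alpha> \<beta>. \<exists>z0 \<in> span B. z = s \<alpha> x + s \<beta> y + z0" if z: "z \<in> C" for z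
  proof -
    obtain \<beta> \<gamma> where bg: "br x z = s \<beta> v" "br y z = s \<gamma> v" using multiples xy z by metis
    \<comment> \<open>The correction is forced by \<open>[x, y] = v\<close> and
      \<open>[y, x] = - v\<close>: it cancels \<open>\<beta> v\<close> in the bracket with
      \<open>x\<close> and \<open>\<gamma> v\<close> in the bracket with \<open>y\<close>.\<close>
    have "z - s \<beta> y + s \<gamma> x \<in> ?Z"
      using xy z bg yx v(1) by (simp add: br_add_right br_diff_right br_scale_right)
    moreover have "z = s (- \<gamma>) x + s \<beta> y + (z - s \<beta> y + s \<gamma> x)" by simp
    ultimately show ?thesis using B(4) by blast
  qed
  have EC: "span ?E = C"
  proof
    show "span ?E \<subseteq> C" by (rule span_minimal[OF _ C_subspace]) (use xy B(2) in auto)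
    show "C \<subseteq> span ?E"
    proof
      fix z assume "z \<in> C"
      then obtain \<alpha> \<beta> z0 where "z0 \<in> span B" "z = s \<alpha> x + s \<beta> y + z0" using decomp by blast
      moreover have "span B \<subseteq> span ?E" by (rule span_mono) blast
      ultimately show "z \<in> span ?E"
        by (auto intro!: span_add span_scale intro: span_base)
    qed
  qed
  obtain xs where xs: "set xs = B - {v}" "distinct xs"
    using finite_distinct_list[of "B - {v}"] B(5) by blast
  \<comment> \<open>\<open>v\<close> stands at position 2 to match the only nonzero bracket of the
    model.\<close>
  define ys where "ys = x # y # v # xs"
  have ys: "set ys = ?E" "distinct ys"
    using xs B(1) \<open>x \<notin> insert y B\<close> \<open>y \<notin> B\<close> unfolding ys_def by auto
  define n where "n = length ys"
  have dimC: "dim C = n"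
    using dim_span_eq_card_independent[OF indE] distinct_card[OF ys(2)] ys(1) EC n_def by simp
  have n3: "3 \<le> n" by (simp add: n_def ys_def)
  let ?r = "representation ?E"
  define f where "f z = (\<lambda>i. if i < n then ?r z (ys ! i) else 0)" for z
  have hom_add: "f (z + w) = f z + f w" if "z \<in> C" "w \<in> C" for z w
    using representation_add[OF indE, of w z] that EC by (auto simp: f_def fun_eq_iff add.commute)
  have hom_scale: "f (s \<alpha> z) = hA_scale \<alpha> (f z)" if "z \<in> C" for z \<alpha>
    using representation_scale[OF indE, of z \<alpha>] that EC by (auto simp: f_def hA_scale_def fun_eq_iff)
  have f_unit: "f (ys ! i) = (\<lambda>j. if j = i then 1 else 0)" if "i < n" for i
  proof
    fix j
    have "ys ! i \<in> ?E" using that nth_mem[of i ys] ys(1) n_def by metis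
    then have "?r (ys ! i) = (\<lambda>b. if b = ys ! i then 1 else 0)" by (rule representation_basis[OF indE])
    then show "f (ys ! i) j = (if j = i then 1 else 0)"
      using that nth_eq_iff_index_eq[OF ys(2), of j i] n_def by (simp add: f_def)
  qed
  have f_v: "f v = (\<lambda>j. if j = 2 then 1 else 0)"
    using f_unit[of 2] n3 by (simp add: ys_def numeral_2_eq_2)
  have f01: "f z 0 = \<alpha>" "f z 1 = \<beta>" if "z0 \<in> span B" "z = s \<alpha> x + s \<beta> y + z0" for z z0 \<alpha> \<beta>
  proof -
    have C: "x \<in> span ?E" "y \<in> span ?E" "z0 \<in> span ?E" using EC xy that(1) BZ by auto
    have "?r z0 = representation B z0"
      by (rule representation_extend[OF indE that(1)]) blast
    then have "?r z0 x = 0" "?r z0 y = 0"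
      using representation_ne_zero[of B z0] \<open>x \<notin> insert y B\<close> \<open>y \<notin> B\<close> by auto
    moreover have "?r z b = \<alpha> * ?r x b + \<beta> * ?r y b + ?r z0 b" for b
      unfolding that(2) using C
      by (simp add: representation_add[OF indE] representation_scale[OF indE] span_add span_scale)
    moreover have "?r x x = 1" "?r y y = 1" "?r x y = 0" "?r y x = 0"
      using representation_basis[OF indE] \<open>x \<notin> insert y B\<close> by auto
    moreover have "ys ! 0 = x" "ys ! 1 = y" by (simp_all add: ys_def)
    ultimately show "f z 0 = \<alpha>" "f z 1 = \<beta>" using n3 by (simp_all add: f_def)
  qed
  have hom_br: "f (br z w) = hA_br (f z) (f w)" if zw: "z \<in> C" "w \<in> C" for z w
  proof -
    obtain \<alpha> \<beta> z0 where z: "z0 \<in> span B" "z = s \<alpha> x + s \<beta> y + z0" using decomp zw by blast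
    obtain \<gamma> \<delta> w0 where w: "w0 \<in> span B" "w = s \<gamma> x + s \<delta> y + w0" using decomp zw by blast
    have Z: "z0 \<in> C" "w0 \<in> C" "br x z0 = 0" "br y z0 = 0" "br x w0 = 0" "br y w0 = 0"
      using z(1) w(1) BZ by auto
    have "br z0 x = 0" "br z0 y = 0"
      using br_antisym[of x z0] br_antisym[of y z0] Z xy by simp_all
    \<comment> \<open>The parts in \<open>?Z\<close> commute with \<open>x\<close>, \<open>y\<close>
      and each other, so only the determinant of the first two coordinates survives.\<close>
    then have "br z w = s (\<alpha> * \<delta> - \<beta> * \<gamma>) v"
      using Z xy orth[OF Z] yx v(1) unfolding z(2) w(2)
      by (simp add: br_add_left br_add_right br_scale_left br_scale_right scale_left_diff_distrib mult.commute)
    then show ?thesis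
      using f01[OF z] f01[OF w] hom_scale[OF vC] f_v by (simp add: hA_br_def hA_scale_def fun_eq_iff)
  qed
  have inj: "inj_on f C"
  proof (rule inj_onI)
    fix z w assume zw: "z \<in> C" "w \<in> C" "f z = f w"
    have "?r z b = ?r w b" if b: "b \<in> ?E" for b
    proof -
      obtain i where i: "i < n" "b = ys ! i" using b ys(1) n_def by (metis in_set_conv_nth)
      then show ?thesis using fun_cong[OF zw(3), of i] by (simp add: f_def)
    qed
    moreover have "(\<Sum>b\<in>?E. s (?r u b) b) = u" if "u \<in> C" for u
      by (rule sum_representation_eq[OF indE]) (use that EC B(5) in auto)
    ultimately show "z = w" using zw by (metis (no_types, lifting) sum.cong)
  qed
  have surj: "f ` C = hA_car n"
  proof
    show "f ` C \<subseteq> hA_car n" by (auto simp: hA_car_def f_def)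
    show "hA_car n \<subseteq> f ` C"
    proof
      fix u :: "nat \<Rightarrow> 'k" assume u: "u \<in> hA_car n"
      have ysC: "ys ! i \<in> C" if "i < n" for i
        using that ys(1) n_def EC span_base nth_mem by metis
      have "(\<Sum>i<k. s (u i) (ys ! i)) \<in> C \<and> f (\<Sum>i<k. s (u i) (ys ! i)) = (\<lambda>j. if j < k then u j else 0)"
        if "k \<le> n" for k using that
      proof (induction k)
        case 0
        have "f 0 = hA_scale 0 (f 0)" using hom_scale[of 0 0] by simp
        then show ?case by (simp add: hA_scale_def fun_eq_iff)
      next
        case (Suc k)
        then show ?case
          using ysC[of k] by (auto simp: hom_add hom_scale f_unit hA_scale_def fun_eq_iff less_Suc_eq)
      qed
      from this[of n] show "u \<in> f ` C"
        using u by (intro image_eqI[of _ _ "\<Sum>i<n. s (u i) (ys ! i)"]) (auto simp: hA_car_def fun_eq_iff)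
    qed
  qed
  have "lie_iso s br C hA_scale hA_br (hA_car n) f"
    unfolding lie_iso_def lie_hom_def bij_betw_def
    using hom_add hom_scale hom_br inj surj by auto
  then show ?thesis unfolding iso_H1_plus_A_def dimC using n3 by blast
qed

end

section \<open>The contribution of the top factor of the derived algebra\<close>

context triple_bracket
begin

text \<open>This is the Jacobi identity of \<open>x\<close>, \<open>y\<close>, \<open>z\<close>
  bracketed with \<open>w\<close>; it is \<open>br2\<close> with the inner bracket moved to the
  first slot.\<close>

lemma jac3:
  assumes "x \<in> C" "y \<in> C" "z \<in> C" "w \<in> C"
  shows "\<tau> (br x y) z w + \<tau> (br y z) x w + \<tau> (br z x) y w = 0"
proof -
  have "\<tau> (br x y) z w = - \<tau> z (br x y) w" using anti[of z "br x y" w] assms by simp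
  moreover have "\<tau> (br z y) x w = - \<tau> (br y z) x w"
    using scale1[of "br y z" x w "- 1"] br_antisym[of y z] assms by simp
  ultimately show ?thesis using br2[of z x y w] assms by simp
qed

text \<open>Modulo \<open>S\<close>, every \<open>[a, b]\<close> acts in the first slot as a
  multiple of \<open>v\<close>. This makes \<open>\<tau> v\<close> symmetric in its last two
  arguments (\<open>sym\<close>) and lets Jacobi reduce each argument to \<open>x\<close> and
  \<open>y\<close> (\<open>red\<close>), which leaves a symmetric form on two vectors.\<close>

lemma top_span:
  assumes xy: "x \<in> C" "y \<in> C" and v: "v = br x y"
    and K': "K' \<subseteq> C" "lie_brk s br C2 C \<subseteq> K'" "\<And>u. u \<in> C2 \<Longrightarrow> \<exists>\<alpha>. u - s \<alpha> v \<in> K'"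
    and S: "V.subspace S" "J K' \<subseteq> S" "\<tau> v x x \<in> S" "\<tau> v x y \<in> S" "\<tau> v y y \<in> S"
    and gh: "g \<in> C" "h \<in> C"
  shows "\<tau> v g h \<in> S"
proof -
  have vC: "v \<in> C" using v xy by simp
  have expand: "\<exists>\<alpha>. \<forall>z\<in>C. \<forall>w\<in>C. \<tau> (br a b) z w - sv \<alpha> (\<tau> v z w) \<in> S" if ab: "a \<in> C" "b \<in> C" for a b
  proof -
    obtain \<alpha> where \<alpha>: "br a b - s \<alpha> v \<in> K'" using K'(3) lie_brkI[OF ab] by blast
    have "\<tau> (br a b) z w - sv \<alpha> (\<tau> v z w) \<in> S" if "z \<in> C" "w \<in> C" for z w
    proof -
      have "\<tau> (br a b) z w = \<tau> (br a b - s \<alpha> v) z w + sv \<alpha> (\<tau> v z w)"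
        using add1[of "br a b - s \<alpha> v" "s \<alpha> v" z w] ab that vC by (simp add: scale1)
      then show ?thesis using JI[OF \<alpha> that] S(2) by auto
    qed
    then show ?thesis by blast
  qed
  have sym: "\<tau> v a b \<in> S" if ab: "a \<in> C" "b \<in> C" and ba: "\<tau> v b a \<in> S" for a b
  proof -
    \<comment> \<open>\<open>\<tau> x y v\<close> vanishes by \<open>br_diag\<close>, so the cyclic
      identity gives symmetry for the pair \<open>x\<close>, \<open>y\<close>.\<close>
    have d0: "\<tau> v x y - \<tau> v y x = 0"
      using cyc[of v x y] anti[of v y x] br_diag[of x y] xy vC v by simp
    obtain \<alpha> where \<alpha>: "\<forall>z\<in>C. \<forall>w\<in>C. \<tau> (br a b) z w - sv \<alpha> (\<tau> v z w) \<in> S" using expand[OF ab] by blast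
    \<comment> \<open>The defect of symmetry for \<open>a\<close>, \<open>b\<close> is
      \<open>\<tau> a b v\<close>; expanding \<open>v = [x, y]\<close> by \<open>br3\<close> reduces
      it, modulo \<open>S\<close>, to a multiple of the defect for \<open>x\<close>,
      \<open>y\<close>.\<close>
    have "\<tau> a b v = (\<tau> (br a b) x y - sv \<alpha> (\<tau> v x y)) - (\<tau> (br a b) y x - sv \<alpha> (\<tau> v y x))
        + sv \<alpha> (\<tau> v x y - \<tau> v y x)"
      using br3[OF ab xy] v by (simp add: V.scale_right_diff_distrib)
    also have "\<dots> \<in> S"
      unfolding d0 using \<alpha> xy S(1) by (simp add: V.subspace_diff)
    finally have "\<tau> a b v \<in> S" .
    moreover have "\<tau> v a b = \<tau> v b a - \<tau> a b v"
      using cyc[of v a b] anti[of v b a] vC ab by (simp add: algebra_simps eq_neg_iff_add_eq_0)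
    ultimately show ?thesis using ba S(1) by (simp add: V.subspace_diff)
  qed
  have red: "\<tau> v z w \<in> S" if zw: "z \<in> C" "w \<in> C" "\<tau> v x w \<in> S" "\<tau> v y w \<in> S" for z w
  proof -
    obtain \<alpha> where \<alpha>: "\<forall>p\<in>C. \<forall>q\<in>C. \<tau> (br y z) p q - sv \<alpha> (\<tau> v p q) \<in> S" using expand[OF xy(2) zw(1)] by blast
    obtain \<beta> where \<beta>: "\<forall>p\<in>C. \<forall>q\<in>C. \<tau> (br z x) p q - sv \<beta> (\<tau> v p q) \<in> S" using expand[OF zw(1) xy(1)] by blast
    have "\<tau> v z w = - (((\<tau> (br y z) x w - sv \<alpha> (\<tau> v x w)) + sv \<alpha> (\<tau> v x w))
        + ((\<tau> (br z x) y w - sv \<beta> (\<tau> v y w)) + sv \<beta> (\<tau> v y w)))"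
      using jac3[OF xy zw(1,2)] v by (simp add: eq_diff_eq eq_neg_iff_add_eq_0 add_ac)
    also have "\<dots> \<in> S"
      using \<alpha> \<beta> xy zw S(1) by (intro V.subspace_neg V.subspace_add V.subspace_scale) auto
    finally show ?thesis .
  qed
  have yx: "\<tau> v y x \<in> S" by (rule sym[OF xy(2,1) S(4)])
  \<comment> \<open>\<open>red\<close> treats the second slot only; \<open>sym\<close> carries its
    result over to the third.\<close>
  have "\<tau> v x h \<in> S" by (rule sym[OF xy(1) gh(2) red[OF gh(2) xy(1) S(3) yx]])
  moreover have "\<tau> v y h \<in> S" by (rule sym[OF xy(2) gh(2) red[OF gh(2) xy(2) S(4,5)]])
  ultimately show ?thesis by (rule red[OF gh])
qed

end

section \<open>Upper bounds for the span of all triple brackets\<close>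

context triple_bracket_nilpotent
begin

text \<open>Modulo \<open>J C2\<close> the map \<open>\<tau>\<close> is trilinear on
  \<open>C\<close> modulo \<open>C2\<close>, so its values on the \<open>a i\<close> suffice;
  antisymmetry and the cyclic identity reduce these to Hall triples.\<close>

lemma hall_span:
  assumes S: "V.subspace S" "(\<lambda>(i, j, k). \<tau> (a i) (a j) (a k)) ` hall_triples c \<subseteq> S"
    and J: "J C2 \<subseteq> S" and xyz: "x \<in> C" "y \<in> C" "z \<in> C"
  shows "\<tau> x y z \<in> S"
proof -
  have hall: "\<tau> (a i) (a j) (a k) \<in> S" if "j < i" "j \<le> k" "i < c" "k < c" for i j k
  proof -
    have "(i, j, k) \<in> hall_triples c" using that by (simp add: hall_triples_def)
    then show ?thesis using subsetD[OF S(2) imageI] by fastforce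
  qed
  have lt: "\<tau> (a i) (a j) (a k) \<in> S" if "j < i" "i < c" "k < c" for i j k
  proof (cases "j \<le> k")
    case False
    have C: "a i \<in> C" "a j \<in> C" "a k \<in> C" using that a_C by auto
    \<comment> \<open>Here \<open>k < j < i\<close>, so both triples on the right are Hall
      triples.\<close>
    have "\<tau> (a i) (a j) (a k) = \<tau> (a i) (a k) (a j) - \<tau> (a j) (a k) (a i)"
      using cyc[OF C] anti[of "a i" "a k" "a j"] C by (simp add: algebra_simps eq_neg_iff_add_eq_0)
    then show ?thesis using hall[of k i j] hall[of k j i] False that S(1) by (simp add: V.subspace_diff)
  qed (use hall that in auto)
  have all: "\<tau> (a i) (a j) (a k) \<in> S" if "i < c" "j < c" "k < c" for i j k
  proof -
    have C: "a i \<in> C" "a j \<in> C" "a k \<in> C" using that a_C by auto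
    consider "j < i" | "i = j" | "i < j" by linarith
    then show ?thesis
    proof cases
      case 2
      then show ?thesis using alt[OF C(1,3)] S(1) by (simp add: V.subspace_0)
    next
      case 3
      then show ?thesis using lt[of i j k] that anti[OF C(2,1,3)] S(1) by (simp add: V.subspace_neg)
    qed (use lt that in auto)
  qed
  have dec: "\<exists>u w. u \<in> span (a ` {..<c}) \<and> u \<in> C \<and> w \<in> C2 \<and> w \<in> C \<and> x = u + w" if "x \<in> C" for x
    using decomp[OF that] span_a_C C2_C by blast
  obtain x1 x2 where x: "x1 \<in> span (a ` {..<c})" "x1 \<in> C" "x2 \<in> C2" "x2 \<in> C" "x = x1 + x2" using dec[OF xyz(1)] by blast
  obtain y1 y2 where y: "y1 \<in> span (a ` {..<c})" "y1 \<in> C" "y2 \<in> C2" "y2 \<in> C" "y = y1 + y2" using dec[OF xyz(2)] by blast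
  obtain z1 z2 where z: "z1 \<in> span (a ` {..<c})" "z1 \<in> C" "z2 \<in> C2" "z2 \<in> C" "z = z1 + z2" using dec[OF xyz(3)] by blast
  have 1: "\<tau> x1 (a j) (a k) \<in> S" if "j < c" "k < c" for j k
    by (rule linear_on_C_span[OF linear_slots(1)[OF a_C a_C, OF that] a_sub S(1) _ x(1)]) (use all that in auto)
  have 2: "\<tau> x1 y1 (a k) \<in> S" if "k < c" for k
    by (rule linear_on_C_span[OF linear_slots(2)[OF x(2) a_C, OF that] a_sub S(1) _ y(1)]) (use 1 that in auto)
  have 3: "\<tau> x1 y1 z1 \<in> S"
    by (rule linear_on_C_span[OF linear_slots(3)[OF x(2) y(2)] a_sub S(1) _ z(1)]) (use 2 in auto)
  have "\<tau> x1 y1 z2 \<in> S" using J_slot3[OF C2_C z(3) x(2) y(2)] J by blast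
  moreover have "\<tau> x1 y2 z \<in> S"
    using anti[OF y(4) x(2) xyz(3)] JI[OF y(3) x(2) xyz(3)] J S(1) V.subspace_neg by auto
  moreover have "\<tau> x2 y z \<in> S" using JI[OF x(3) xyz(2,3)] J by blast
  moreover have "\<tau> x y z = \<tau> x1 y1 z1 + \<tau> x1 y1 z2 + \<tau> x1 y2 z + \<tau> x2 y z"
    using x y z xyz by (simp add: x(5) add1 add3 y(5) add2 z(5))
  ultimately show ?thesis using 3 S(1) by (simp add: V.subspace_add)
qed

text \<open>Brackets span \<open>C2\<close>, so one of them lies outside the hyperplane ideal
  \<open>K'\<close> and, after rescaling, replaces the complementary vector \<open>v\<close>.
  \<open>top_span\<close> needs this vector to be a bracket.\<close>

lemma C2_hyperplane:
  assumes m: "dim C2 = Suc m"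
  obtains x y K' where "x \<in> C" "y \<in> C" "br x y \<notin> K'" "subspace K'" "K' \<subseteq> C2" "lie_brk s br C2 C \<subseteq> K'"
    "dim K' = m" "\<And>u. u \<in> C2 \<Longrightarrow> \<exists>\<alpha>. u - s \<alpha> (br x y) \<in> K'"
proof -
  have "lie_brk s br C2 C \<subseteq> C2" by (rule lie_brk_mono[OF C2_C]) simp
  then obtain v K' where v: "v \<in> C2" "v \<notin> K'" "subspace K'" "K' \<subseteq> C2" "lie_brk s br C2 C \<subseteq> K'" "dim K' = m"
    "\<And>x. x \<in> C2 \<Longrightarrow> \<exists>a. x - s a v \<in> K'"
    using ideal_hyperplane[OF fd nil lie_brk_subspace C2_C _ m] by metis
  have "\<not> C2 \<subseteq> K'" using v by blast
  then obtain x y where xy: "x \<in> C" "y \<in> C" "br x y \<notin> K'"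
    using lie_brk_least[OF v(3)] by metis
  obtain \<beta> where \<beta>: "br x y - s \<beta> v \<in> K'" using v(7) lie_brkI xy by metis
  have "\<beta> \<noteq> 0" using \<beta> xy(3) by auto
  have "\<exists>\<alpha>. u - s \<alpha> (br x y) \<in> K'" if u: "u \<in> C2" for u
  proof -
    obtain \<alpha> where \<alpha>: "u - s \<alpha> v \<in> K'" using v(7) u by blast
    have "u - s (\<alpha> / \<beta>) (br x y) = (u - s \<alpha> v) - s (\<alpha> / \<beta>) (br x y - s \<beta> v)"
      using \<open>\<beta> \<noteq> 0\<close> by (simp add: scale_right_diff_distrib)
    also have "\<dots> \<in> K'" using \<alpha> \<beta> v(3) subspace_diff subspace_scale by blast
    finally show ?thesis by blast
  qed
  then show thesis using that xy v by blast
qed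

text \<open>Three sources add up: the Hall triples, \<open>J_bound\<close> for the hyperplane ideal
  of dimension \<open>m - 1\<close>, and the three values left by \<open>top_span\<close>.\<close>

lemma triple_span_bound:
  assumes m: "dim C2 = m" "m \<ge> 1"
  obtains T where "finite T" "card T \<le> card (hall_triples c) + (m - 1) * c\<^sup>2 + 3"
    "\<And>x y z. \<lbrakk>x \<in> C; y \<in> C; z \<in> C\<rbrakk> \<Longrightarrow> \<tau> x y z \<in> V.span T"
proof -
  have "dim C2 = Suc (m - 1)" using m by simp
  then obtain x y K' where K': "x \<in> C" "y \<in> C" "br x y \<notin> K'" "subspace K'" "K' \<subseteq> C2" "lie_brk s br C2 C \<subseteq> K'"
    "dim K' = m - 1" "\<And>u. u \<in> C2 \<Longrightarrow> \<exists>\<alpha>. u - s \<alpha> (br x y) \<in> K'"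
    using C2_hyperplane by metis
  have K'C: "K' \<subseteq> C" using K'(5) C2_C by blast
  have "lie_brk s br K' C \<subseteq> K'" using lie_brk_mono[OF K'(5), of C C] K'(6) by blast
  then obtain T where T: "finite T" "card T \<le> (m - 1) * c\<^sup>2" "J K' \<subseteq> V.span T"
    using J_bound[OF K'(4) K'C _ K'(7)] by blast
  let ?v = "br x y"
  let ?H = "(\<lambda>(i, j, k). \<tau> (a i) (a j) (a k)) ` hall_triples c"
  let ?B = "{\<tau> ?v x x, \<tau> ?v x y, \<tau> ?v y y}"
  let ?S = "V.span (?H \<union> T \<union> ?B)"
  have sub: "?H \<subseteq> ?S" "?B \<subseteq> ?S" using V.span_superset[of "?H \<union> T \<union> ?B"] by auto
  have "V.span T \<subseteq> ?S" by (rule V.span_mono) blast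
  then have JK': "J K' \<subseteq> ?S" using T(3) by blast
  have top: "\<tau> ?v g h \<in> ?S" if "g \<in> C" "h \<in> C" for g h
    by (rule top_span[OF K'(1,2) refl K'C K'(6,8) _ JK' _ _ _ that]) (use sub(2) in auto)
  have "J C2 \<subseteq> ?S"
    by (rule J_extend[OF C2_C K'(5) lie_brkI[OF K'(1,2)] K'(8) _ JK' top]) auto
  then have span: "\<tau> x y z \<in> ?S" if "x \<in> C" "y \<in> C" "z \<in> C" for x y z
    using hall_span[OF V.subspace_span sub(1) _ that] by blast
  have card: "card (?H \<union> T \<union> ?B) \<le> card (hall_triples c) + (m - 1) * c\<^sup>2 + 3"
  proof -
    have "card (?H \<union> T \<union> ?B) \<le> card ?H + card T + card ?B"
      using card_Un_le[of "?H \<union> T" ?B] card_Un_le[of ?H T] by linarith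
    moreover have "card ?H \<le> card (hall_triples c)" by (rule card_image_le) simp
    moreover have "card ?B \<le> 3" by (simp add: card_insert_if)
    ultimately show ?thesis using T(2) by linarith
  qed
  have "finite (?H \<union> T \<union> ?B)" using T(1) by simp
  then show thesis using card span by (rule that)
qed

text \<open>If \<open>J C2\<close> vanishes, the Hall triples span alone. Otherwise a nonzero value
  of \<open>\<tau> ?v\<close> forces, through Jacobi, the commutator form to vanish on the common
  centraliser of \<open>x\<close> and \<open>y\<close>, and \<open>iso_H1_plus_A_criterion\<close>
  applies.\<close>

lemma triple_span_bound_or_iso:
  assumes m: "dim C2 = 1"
  obtains "iso_H1_plus_A s br C (dim C)"
  | T where "finite T" "card T \<le> card (hall_triples c)"
    "\<And>x y z. \<lbrakk>x \<in> C; y \<in> C; z \<in> C\<rbrakk> \<Longrightarrow> \<tau> x y z \<in> V.span T"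
proof (cases "J C2 \<subseteq> {0}")
  case True
  let ?H = "(\<lambda>(i, j, k). \<tau> (a i) (a j) (a k)) ` hall_triples c"
  have "J C2 \<subseteq> V.span ?H" using True by (auto simp: V.span_zero)
  then have span: "\<tau> x y z \<in> V.span ?H" if "x \<in> C" "y \<in> C" "z \<in> C" for x y z
    using hall_span[OF V.subspace_span V.span_superset _ that] by blast
  have "finite ?H" by simp
  moreover have "card ?H \<le> card (hall_triples c)" by (rule card_image_le) simp
  ultimately show thesis using span by (rule that(2))
next
  case J: False
  obtain x y K' where K': "x \<in> C" "y \<in> C" "br x y \<notin> K'" "subspace K'" "K' \<subseteq> C2" "lie_brk s br C2 C \<subseteq> K'"
    "dim K' = 0" "\<And>u. u \<in> C2 \<Longrightarrow> \<exists>\<alpha>. u - s \<alpha> (br x y) \<in> K'"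
    by (rule C2_hyperplane[of 0]) (use m in simp_all)
  let ?v = "br x y"
  have vC: "?v \<in> C" "?v \<in> C2" using K'(1,2) lie_brkI by auto
  have "K' \<subseteq> C" using K'(5) C2_C by blast
  obtain T where "finite T" "C \<subseteq> span T" using fd unfolding fin_dim_def by blast
  then obtain B where "finite B" "card B = dim K'" "K' \<subseteq> span B"
    using extend_to_finite_basis[of T K' "{}"] \<open>K' \<subseteq> C\<close> by (metis empty_subsetI independent_empty subset_trans)
  then have K'0: "K' = {0}" using K'(7) subspace_0[OF K'(4)] by auto
  have v0: "?v \<noteq> 0" using K'(3) K'0 by blast
  have mult: "\<exists>\<alpha>. br u w = s \<alpha> ?v" if "u \<in> C" "w \<in> C" for u w
    using K'(8)[OF lie_brkI[OF that]] K'0 by simp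
  have central: "br ?v u = 0" if "u \<in> C" for u
    using lie_brkI[OF vC(2) that] K'(6) K'0 by blast
  have JK': "J K' \<subseteq> {0}"
    by (rule J_least) (use K'0 scale1[of 0 _ _ 0] in auto)
  have "\<not> (\<forall>g\<in>C. \<forall>h\<in>C. \<tau> ?v g h \<in> {0})"
  proof
    assume "\<forall>g\<in>C. \<forall>h\<in>C. \<tau> ?v g h \<in> {0}"
    then have "J C2 \<subseteq> {0}"
      by (intro J_extend[OF C2_C K'(5) vC(2) K'(8) _ JK']) auto
    then show False using J by blast
  qed
  \<comment> \<open>Otherwise \<open>top_span\<close> with the zero subspace would annihilate all
    values of \<open>\<tau> ?v\<close>.\<close>
  then have nz: "\<exists>g\<in>C. \<tau> ?v x g \<noteq> 0 \<or> \<tau> ?v y g \<noteq> 0"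
    using top_span[OF K'(1,2) refl \<open>K' \<subseteq> C\<close> K'(6,8) V.subspace_single_0 JK'] K'(1,2) by blast
  have orth: "br u w = 0"
    if uw: "u \<in> C" "w \<in> C" and perp: "br x u = 0" "br y u = 0" "br x w = 0" "br y w = 0" for u w
  proof (rule ccontr)
    assume "br u w \<noteq> 0"
    moreover obtain \<alpha> where \<alpha>: "br u w = s \<alpha> ?v" using mult uw by blast
    ultimately have "\<alpha> \<noteq> 0" by auto
    have zero: "\<tau> 0 p q = 0" if "p \<in> C" "q \<in> C" for p q using scale1[of 0 p q 0] that by simp
    \<comment> \<open>As \<open>z\<close> commutes with \<open>u\<close> and \<open>w\<close>,
      \<open>jac3\<close> leaves only the term with \<open>[u, w] = \<alpha> ?v\<close>. Taking
      \<open>z\<close> to be \<open>x\<close> and \<open>y\<close> contradicts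
      \<open>nz\<close>.\<close>
    have *: "\<tau> ?v z g = 0" if z: "z \<in> C" "br z u = 0" "br z w = 0" and g: "g \<in> C" for z g
    proof -
      have "br w z = 0" using br_antisym[of z w] z uw by simp
      then have "\<tau> (br u w) z g = 0"
        using jac3[OF uw z(1) g] z uw g zero by simp
      then show ?thesis using scale1[OF vC(1) z(1) g, of \<alpha>] \<alpha> \<open>\<alpha> \<noteq> 0\<close> by simp
    qed
    show False using nz *[of x] *[of y] K'(1,2) perp by blast
  qed
  show thesis
    by (rule that(1), rule iso_H1_plus_A_criterion[OF fd K'(1,2) refl v0 mult central orth])
qed

end

section \<open>Free Lie algebras\<close>

lemma (in lie_algebra) lie_alg_subalgebra:
  assumes "subspace S" "S \<subseteq> C" "\<And>x y. x \<in> S \<Longrightarrow> y \<in> S \<Longrightarrow> br x y \<in> S"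
  shows "lie_alg s S br"
  using lie assms unfolding lie_alg_def by (meson subsetD)

lemma free_lie_algebra: "free_lie_on s br F X \<Longrightarrow> lie_algebra s F br"
  by unfold_locales (simp add: free_lie_on_def)

lemma free_lie_ex_hom:
  assumes "free_lie_on s br F X" "lie_alg s M brM" "\<phi> ` X \<subseteq> M"
  shows "\<exists>\<psi>. lie_hom s br F s brM M \<psi> \<and> (\<forall>x\<in>X. \<psi> x = \<phi> x)"
  by (rule assms(1)[unfolded free_lie_on_def, THEN conjunct2, THEN conjunct2, THEN spec, THEN spec,
    THEN spec, THEN mp, OF conjI[OF assms(2,3)], THEN conjunct1])

lemma free_lie_unique_hom:
  assumes "free_lie_on s br F X" "lie_alg s M brM" "lie_hom s br F s brM M \<psi>1" "lie_hom s br F s brM M \<psi>2"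
    and "\<And>x. x \<in> X \<Longrightarrow> \<psi>1 x = \<psi>2 x" "y \<in> F"
  shows "\<psi>1 y = \<psi>2 y"
proof -
  have XF: "X \<subseteq> F" using assms(1) by (simp add: free_lie_on_def)
  have "\<psi>1 ` X \<subseteq> M" using assms(3) XF unfolding lie_hom_def by blast
  note unique = assms(1)[unfolded free_lie_on_def, THEN conjunct2, THEN conjunct2, THEN spec, THEN spec,
      THEN spec, THEN mp, OF conjI[OF assms(2) this], THEN conjunct2, THEN spec, THEN spec, THEN mp,
      THEN bspec, OF _ assms(6), of \<psi>1 \<psi>2]
  show ?thesis
    by (rule unique) (intro conjI ballI assms(3,4) refl, rule assms(5)[symmetric])
qed

text \<open>The elements satisfying \<open>P\<close> form a subalgebra containing \<open>X\<close>.
  The homomorphism into it that fixes \<open>X\<close> is also an endomorphism of \<open>F\<close>,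
  so by uniqueness it is the identity, and the subalgebra is all of \<open>F\<close>.\<close>

lemma free_lie_induct:
  assumes free: "free_lie_on s br F X" and y: "y \<in> F"
    and S: "module.subspace s {x \<in> F. P x}"
    and gen: "\<And>x. x \<in> X \<Longrightarrow> P x"
    and step: "\<And>x y. \<lbrakk>x \<in> F; y \<in> F; P x; P y\<rbrakk> \<Longrightarrow> P (br x y)"
  shows "P y"
proof -
  interpret lie_algebra s F br by (rule free_lie_algebra[OF free])
  let ?S = "{x \<in> F. P x}"
  have XF: "X \<subseteq> F" using free by (simp add: free_lie_on_def)
  have S': "lie_alg s ?S br" by (rule lie_alg_subalgebra[OF S]) (use step in auto)
  have "id ` X \<subseteq> ?S" using XF gen by auto
  from free_lie_ex_hom[OF free S' this]
  obtain \<psi> where \<psi>: "lie_hom s br F s br ?S \<psi>" "\<forall>x\<in>X. \<psi> x = id x" by (elim exE conjE)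
  have "lie_hom s br F s br F \<psi>" using \<psi>(1) unfolding lie_hom_def by auto
  moreover have "lie_hom s br F s br F id" unfolding lie_hom_def by auto
  ultimately have "\<psi> y = id y" by (rule free_lie_unique_hom[OF free lie _ _ _ y]) (use \<psi>(2) in blast)
  then have "\<psi> y = y" by simp
  moreover have "\<psi> y \<in> ?S" using \<psi>(1) y unfolding lie_hom_def by blast
  ultimately show ?thesis by simp
qed

lemma lie_hom_sum:
  assumes "lie_hom s1 br1 C1 s2 br2 C2 \<psi>" "lie_algebra s1 C1 br1" "vector_space s2"
    and "finite I" "\<And>i. i \<in> I \<Longrightarrow> v i \<in> C1"
  shows "\<psi> (\<Sum>i\<in>I. s1 (a i) (v i)) = (\<Sum>i\<in>I. s2 (a i) (\<psi> (v i)))"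
proof -
  interpret D: lie_algebra s1 C1 br1 by fact
  interpret V2: vector_space s2 by fact
  note hom = assms(1)[unfolded lie_hom_def]
  have "\<psi> 0 = 0" using hom[THEN conjunct2, THEN conjunct2, rule_format, of 0 0] by simp
  have "(\<Sum>i\<in>I. s1 (a i) (v i)) \<in> C1 \<and> ?thesis"
    using assms(4,5)
    by (induction I rule: finite_induct) (use hom \<open>\<psi> 0 = 0\<close> in auto)
  then show ?thesis ..
qed

section \<open>The universal property for targets in other types\<close>

lemma lie_alg_transport:
  fixes sg :: "'k::field \<Rightarrow> 'g::ab_group_add \<Rightarrow> 'g" and sf :: "'k \<Rightarrow> 'f::ab_group_add \<Rightarrow> 'f"
  assumes G: "lie_alg sg G bg" and sf: "vector_space sf"
    and add: "\<And>u v. \<lbrakk>u \<in> G; v \<in> G\<rbrakk> \<Longrightarrow> j (u + v) = j u + j v"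
    and scale: "\<And>a u. u \<in> G \<Longrightarrow> j (sg a u) = sf a (j u)"
    and inj: "inj_on j G"
  shows "lie_alg sf (j ` G) (\<lambda>u v. j (bg (inv_into G j u) (inv_into G j v)))"
proof -
  interpret G: lie_algebra sg G bg by unfold_locales (rule G)
  interpret V: vector_space sf by (rule sf)
  have inv: "inv_into G j (j u) = u" if "u \<in> G" for u using inj that by simp
  have j0: "j 0 = 0" using scale[of 0 0] by simp
  have sub: "V.subspace (j ` G)"
  proof (rule V.subspaceI)
    show "0 \<in> j ` G" using imageI[OF G.C_0, of j] j0 by simp
    fix x y a assume x: "x \<in> j ` G" and y: "y \<in> j ` G"
    then obtain u v where uv: "u \<in> G" "x = j u" "v \<in> G" "y = j v" by auto
    show "x + y \<in> j ` G" using imageI[of "u + v" G j] uv add by simp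
    show "sf a x \<in> j ` G" using imageI[of "sg a u" G j] uv scale by simp
  qed
  show ?thesis
    unfolding lie_alg_def ball_simps
    by (intro conjI ballI allI sf sub)
       (use G.jacobi in \<open>simp_all add: inv add[symmetric] scale[symmetric] j0 G.br_add_left G.br_add_right G.br_scale_left G.br_scale_right\<close>)
qed

text \<open>\<open>free_lie_on\<close> quantifies over targets in the ambient space of
  \<open>F\<close> only. A target that embeds linearly by \<open>j\<close> is copied there, the
  universal property is applied to the copy, and the result is pulled back.\<close>

lemma free_lie_extend:
  fixes sg :: "'k::field \<Rightarrow> 'g::ab_group_add \<Rightarrow> 'g" and sf :: "'k \<Rightarrow> 'f::ab_group_add \<Rightarrow> 'f"
  assumes free: "free_lie_on sf bf F X" and G: "lie_alg sg G bg"
    and add: "\<And>u v. \<lbrakk>u \<in> G; v \<in> G\<rbrakk> \<Longrightarrow> j (u + v) = j u + j v"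
    and scale: "\<And>a u. u \<in> G \<Longrightarrow> j (sg a u) = sf a (j u)"
    and inj: "inj_on j G" and \<phi>: "\<phi> ` X \<subseteq> G"
  shows "\<exists>\<psi>. lie_hom sf bf F sg bg G \<psi> \<and> (\<forall>x\<in>X. \<psi> x = \<phi> x)"
proof -
  interpret F: lie_algebra sf F bf by (rule free_lie_algebra[OF free])
  interpret G: lie_algebra sg G bg by unfold_locales (rule G)
  let ?br = "\<lambda>u v. j (bg (inv_into G j u) (inv_into G j v))"
  have inv: "inv_into G j (j u) = u" if "u \<in> G" for u using inj that by simp
  have G': "lie_alg sf (j ` G) ?br"
    by (rule lie_alg_transport[OF G F.vector_space_axioms add scale inj])
  have "(j \<circ> \<phi>) ` X \<subseteq> j ` G" using \<phi> by auto
  from free_lie_ex_hom[OF free G' this] obtain \<chi> where \<chi>: "lie_hom sf bf F sf ?br (j ` G) \<chi>" "\<forall>x\<in>X. \<chi> x = (j \<circ> \<phi>) x"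
    by (elim exE conjE)
  have im: "\<exists>u\<in>G. \<chi> y = j u" if "y \<in> F" for y using \<chi>(1) that unfolding lie_hom_def by blast
  have "lie_hom sf bf F sg bg G (\<lambda>y. inv_into G j (\<chi> y))"
    unfolding lie_hom_def
  proof (intro conjI ballI allI)
    show "(\<lambda>y. inv_into G j (\<chi> y)) ` F \<subseteq> G" using im inv by force
    fix x a assume x: "x \<in> F"
    then obtain u where u: "u \<in> G" "\<chi> x = j u" using im by blast
    have "\<chi> (sf a x) = j (sg a u)" using \<chi>(1) x u scale unfolding lie_hom_def by simp
    then show "inv_into G j (\<chi> (sf a x)) = sg a (inv_into G j (\<chi> x))" using u by (simp add: inv)
  next
    fix x y assume xy: "x \<in> F" "y \<in> F"
    then obtain u v where uv: "u \<in> G" "\<chi> x = j u" "v \<in> G" "\<chi> y = j v" using im by metis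
    have "\<chi> (x + y) = j (u + v)" "\<chi> (bf x y) = j (bg u v)"
      using \<chi>(1) xy uv add inv unfolding lie_hom_def by simp_all
    then show "inv_into G j (\<chi> (x + y)) = inv_into G j (\<chi> x) + inv_into G j (\<chi> y)"
      "inv_into G j (\<chi> (bf x y)) = bg (inv_into G j (\<chi> x)) (inv_into G j (\<chi> y))"
      using uv by (simp_all add: inv)
  qed
  moreover have "\<forall>x\<in>X. inv_into G j (\<chi> x) = \<phi> x" using \<chi>(2) \<phi> inv by auto
  ultimately show ?thesis by blast
qed

definition fun_scale :: "'k::field \<Rightarrow> ('i \<Rightarrow> 'k) \<Rightarrow> 'i \<Rightarrow> 'k" where
  "fun_scale c v = (\<lambda>i. c * v i)"

lemma fun_scale_apply [simp]: "fun_scale c v i = c * v i"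
  by (simp add: fun_scale_def)

lemma vector_space_fun_scale: "vector_space fun_scale"
  by unfold_locales (auto simp: fun_eq_iff algebra_simps)

lemma sum_fun_apply: "(\<Sum>i\<in>I. f i) x = (\<Sum>i\<in>I. f i x)" for f :: "'a \<Rightarrow> 'b \<Rightarrow> 'c::ab_group_add"
  by (induction I rule: infinite_finite_induct) auto

text \<open>A Lie algebra of functions supported on a finite set \<open>I\<close> embeds as soon as
  the ambient space has \<open>card I\<close> independent vectors to serve as images of the unit
  vectors.\<close>

lemma free_lie_extend_fun:
  fixes sf :: "'k::field \<Rightarrow> 'f::ab_group_add \<Rightarrow> 'f" and G :: "('i \<Rightarrow> 'k) set"
  assumes free: "free_lie_on sf bf F X" and G: "lie_alg fun_scale G bg"
    and I: "finite I" "\<And>v i. v \<in> G \<Longrightarrow> i \<notin> I \<Longrightarrow> v i = 0"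
    and B: "finite B" "card B = card I" "\<not> module.dependent sf B"
    and \<phi>: "\<phi> ` X \<subseteq> G"
  shows "\<exists>\<psi>. lie_hom sf bf F fun_scale bg G \<psi> \<and> (\<forall>x\<in>X. \<psi> x = \<phi> x)"
proof -
  interpret F: lie_algebra sf F bf by (rule free_lie_algebra[OF free])
  obtain b where b: "bij_betw b I B" using finite_same_card_bij[OF I(1) B(1)] B(2) by metis
  let ?j = "\<lambda>v. \<Sum>i\<in>I. sf (v i) (b i)"
  have inj: "inj_on ?j G"
  proof (rule inj_onI)
    fix u v assume uv: "u \<in> G" "v \<in> G" "?j u = ?j v"
    let ?w = "\<lambda>y. (u - v) (inv_into I b y)"
    have "0 = ?j (u - v)"
      using uv(3) by (simp add: F.scale_left_diff_distrib sum_subtractf)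
    also have "\<dots> = (\<Sum>i\<in>I. sf (?w (b i)) (b i))"
      using b by (intro sum.cong) (auto simp: bij_betw_def)
    also have "\<dots> = (\<Sum>y\<in>B. sf (?w y) y)" by (rule sum.reindex_bij_betw[OF b])
    finally have "?w y = 0" if "y \<in> B" for y
      using F.independentD[OF B(3,1) subset_refl _ that, of ?w] by simp
    then have "u i = v i" if "i \<in> I" for i
      using that b by (force simp: bij_betw_def)
    then show "u = v" using I(2) uv(1,2) by (metis ext)
  qed
  show ?thesis
    by (rule free_lie_extend[OF free G _ _ inj \<phi>])
      (simp_all add: F.scale_left_distrib sum.distrib F.scale_sum_right)
qed

text \<open>With zero bracket the ambient space is itself an admissible target, so every map on
  \<open>X\<close> extends linearly to \<open>F\<close>; maps supported at a single generator rule
  out linear relations.\<close>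

lemma free_lie_gens_independent:
  assumes free: "free_lie_on sf bf F X" and xy: "x \<in> X" "y \<in> X" "x \<noteq> y"
  shows "\<not> module.dependent sf {x, y}"
proof -
  interpret F: lie_algebra sf F bf by (rule free_lie_algebra[OF free])
  obtain b :: 'b where b: "b \<noteq> 0" using xy(3) by metis
  have ab: "lie_alg sf UNIV (\<lambda>_ _. 0)"
    unfolding lie_alg_def by (simp add: F.vector_space_axioms)
  have "\<exists>\<psi>. lie_hom sf bf F sf (\<lambda>_ _. 0) UNIV \<psi> \<and> (\<forall>x\<in>X. \<psi> x = \<phi> x)" for \<phi>
    by (rule free_lie_ex_hom[OF free ab]) auto
  then obtain \<psi> where \<psi>: "\<And>\<phi>. lie_hom sf bf F sf (\<lambda>_ _. 0) UNIV (\<psi> \<phi>)"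
      "\<And>\<phi> x. x \<in> X \<Longrightarrow> \<psi> \<phi> x = \<phi> x" by metis
  have XF: "X \<subseteq> F" using free by (simp add: free_lie_on_def)
  have sc: "\<psi> \<phi> (sf a z) = sf a (\<psi> \<phi> z)" if "z \<in> F" for \<phi> a z
    using \<psi>(1) that unfolding lie_hom_def by blast
  let ?d = "\<lambda>z w. if w = z then b else 0"
  have "y \<noteq> 0"
  proof
    assume "y = 0"
    then show False using sc[of y "?d y" 0] \<psi>(2)[OF xy(2), of "?d y"] xy XF b by auto
  qed
  moreover have "x \<notin> F.span {y}"
  proof
    assume "x \<in> F.span {y}"
    then obtain c where "x = sf c y" unfolding F.span_singleton by blast
    then show False using sc[of y "?d x" c] \<psi>(2)[OF xy(1), of "?d x"] \<psi>(2)[OF xy(2), of "?d x"] xy XF b by auto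
  qed
  ultimately show ?thesis using xy(3) by (simp add: F.independent_insert)
qed

section \<open>The ambient space of a free Lie algebra on two or more generators is
  infinite-dimensional\<close>

text \<open>The map sends \<open>e_1\<close> to \<open>e_2\<close>, and so on up to
  \<open>e_(N-1)\<close>, which goes to \<open>t e_1\<close>; coordinate 0 is reserved for the
  acting line.\<close>

definition shift :: "'k::field \<Rightarrow> nat \<Rightarrow> (nat \<Rightarrow> 'k) \<Rightarrow> nat \<Rightarrow> 'k" where
  "shift t N v = (\<lambda>i. if i = 1 then t * v (N - 1) else if 2 \<le> i \<and> i < N then v (i - 1) else 0)"

definition shift_br :: "'k::field \<Rightarrow> nat \<Rightarrow> (nat \<Rightarrow> 'k) \<Rightarrow> (nat \<Rightarrow> 'k) \<Rightarrow> nat \<Rightarrow> 'k" where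
  "shift_br t N u v = (\<lambda>i. u 0 * shift t N v i - v 0 * shift t N u i)"

lemma lie_alg_shift:
  assumes N: "2 \<le> N"
  shows "lie_alg fun_scale (hA_car N) (shift_br t N)"
  unfolding lie_alg_def
proof (intro conjI ballI allI)
  interpret vector_space fun_scale by (rule vector_space_fun_scale)
  show "vector_space fun_scale" by (rule vector_space_fun_scale)
  show "subspace (hA_car N)" by (rule subspaceI) (auto simp: hA_car_def)
qed (use N in \<open>auto simp: hA_car_def shift_br_def shift_def fun_eq_iff algebra_simps\<close>)

text \<open>The semidirect products of a line with an (N - 1)-dimensional space on which it acts by
  the nilpotent (t = 0) or the cyclic (t = 1) shift show that N + 1 iterated brackets of two free
  generators are independent, so the ambient space cannot have dimension N.\<close>

lemma free_lie_infinite_dimensional: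
  fixes sf :: "'k::field \<Rightarrow> 'f::ab_group_add \<Rightarrow> 'f"
  assumes free: "free_lie_on sf bf F X" and xy: "x \<in> X" "y \<in> X" "x \<noteq> y"
    and T: "finite T"
  shows "module.span sf T \<noteq> UNIV"
proof
  assume span: "module.span sf T = UNIV"
  interpret F: lie_algebra sf F bf by (rule free_lie_algebra[OF free])
  obtain B where B: "{x, y} \<subseteq> B" "F.independent B" "finite B" "card B = F.dim UNIV"
    using F.extend_to_finite_basis[OF T, of UNIV "{x, y}"] span free_lie_gens_independent[OF free xy]
    by (metis subset_UNIV)
  define N where "N = F.dim UNIV"
  have N: "2 \<le> N" using card_mono[OF B(3,1)] B(4) xy(3) by (simp add: N_def)
  have XF: "x \<in> F" "y \<in> F" using free xy by (auto simp: free_lie_on_def)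
  define e :: "nat \<Rightarrow> nat \<Rightarrow> 'k" where "e i = (\<lambda>j. if j = i then 1 else 0)" for i
  \<comment> \<open>The test elements are \<open>x\<close>, \<open>y\<close>, \<open>[x, y]\<close>,
    \<open>[x, [x, y]]\<close> and so on; \<open>v 0\<close> to \<open>v N\<close> are one more than
    the supposed dimension.\<close>
  define v where "v i = (if i = 0 then x else ((bf x) ^^ (i - 1)) y)" for i
  have vF: "v i \<in> F" for i
  proof -
    have "((bf x) ^^ k) y \<in> F" for k by (induction k) (use XF in auto)
    then show ?thesis using XF by (simp add: v_def)
  qed
  have ex: "\<exists>\<psi>. lie_hom sf bf F fun_scale (shift_br t N) (hA_car N) \<psi>
      \<and> (\<forall>i<N. \<psi> (v i) = e i) \<and> \<psi> (v N) = fun_scale t (e 1)" for t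
  proof -
    have "\<exists>\<psi>. lie_hom sf bf F fun_scale (shift_br t N) (hA_car N) \<psi> \<and>
        (\<forall>z\<in>X. \<psi> z = (if z = x then e 0 else e 1))"
    proof (rule free_lie_extend_fun[OF free lie_alg_shift[OF N] _ _ B(3) _ B(2)])
      show "card B = card {..<N}" using B(4) by (simp add: N_def)
      show "(\<lambda>z. if z = x then e 0 else e 1) ` X \<subseteq> hA_car N"
        using N by (auto simp: hA_car_def e_def)
    qed (auto simp: hA_car_def)
    then obtain \<psi> where \<psi>: "lie_hom sf bf F fun_scale (shift_br t N) (hA_car N) \<psi>"
      "\<And>z. z \<in> X \<Longrightarrow> \<psi> z = (if z = x then e 0 else e 1)" by blast
    have br: "\<psi> (bf x z) = shift t N (\<psi> z) - fun_scale (\<psi> z 0) (shift t N (e 0))" if "z \<in> F" for z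
    proof -
      have "\<psi> (bf x z) = shift_br t N (e 0) (\<psi> z)"
        using \<psi>(1) \<psi>(2)[OF xy(1)] XF that by (simp add: lie_hom_def)
      then show ?thesis by (simp add: shift_br_def fun_eq_iff) (simp add: e_def)
    qed
    have s0: "shift t N (e 0) = 0" using N by (auto simp: shift_def e_def fun_eq_iff)
    have pow: "\<psi> (((bf x) ^^ k) y) = e (Suc k)" if "Suc k < N" for k
      using that
    proof (induction k)
      case 0
      then show ?case using \<psi>(2)[OF xy(2)] xy(3) by simp
    next
      case (Suc k)
      have "((bf x) ^^ k) y \<in> F" using vF[of "Suc k"] by (simp add: v_def)
      then show ?case using Suc br s0 by (auto simp: shift_def e_def fun_eq_iff)
    qed
    obtain M where M: "N = Suc (Suc M)" using N by (metis add_2_eq_Suc le_Suc_ex)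
    have "((bf x) ^^ M) y \<in> F" using vF[of "Suc M"] by (simp add: v_def)
    then have "\<psi> (v N) = fun_scale t (e 1)"
      using br s0 pow[of M] by (auto simp: M v_def shift_def e_def fun_eq_iff)
    moreover have "\<psi> (v i) = e i" if "i < N" for i
      using that pow[of "i - 1"] \<psi>(2)[OF xy(1)] by (cases i) (auto simp: v_def)
    ultimately show ?thesis using \<psi>(1) by blast
  qed
  obtain \<psi>0 where \<psi>0: "lie_hom sf bf F fun_scale (shift_br 0 N) (hA_car N) \<psi>0"
    "\<And>i. i < N \<Longrightarrow> \<psi>0 (v i) = e i" "\<psi>0 (v N) = 0" using ex[of 0] by (auto simp: fun_eq_iff fun_scale_def zero_fun_def)
  obtain \<psi>1 where \<psi>1: "lie_hom sf bf F fun_scale (shift_br 1 N) (hA_car N) \<psi>1"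
    "\<psi>1 (v N) = e 1" using ex[of 1] by (auto simp: fun_scale_def)
  have "card {..N} \<le> F.dim UNIV"
  proof (rule F.card_le_dim_family[OF T])
    \<comment> \<open>The homomorphism for \<open>t = 0\<close> kills \<open>v N\<close> and
      isolates the first \<open>N\<close> coefficients; the one for \<open>t = 1\<close> then yields
      the last.\<close>
    fix a assume a: "(\<Sum>i\<in>{..N}. sf (a i) (v i)) = 0"
    have "\<psi>0 0 = 0"
      using lie_hom_sum[OF \<psi>0(1) F.lie_algebra_axioms vector_space_fun_scale, of "{}"] by simp
    then have "0 = (\<Sum>i\<le>N. fun_scale (a i) (\<psi>0 (v i)))"
      using lie_hom_sum[OF \<psi>0(1) F.lie_algebra_axioms vector_space_fun_scale, of "{..N}" v a] a vF by simp
    also have "\<dots> = (\<Sum>i<N. fun_scale (a i) (e i))"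
      unfolding lessThan_Suc_atMost[symmetric] sum.lessThan_Suc
      using \<psi>0(2,3) by (simp add: fun_scale_def zero_fun_def[symmetric])
    finally have z: "(\<Sum>i<N. fun_scale (a i) (e i)) = 0" by simp
    have a0: "a j = 0" if "j < N" for j
      using fun_cong[OF z, of j] that by (simp add: sum_fun_apply e_def if_distrib[where f = "(*) _"] cong: if_cong)
    then have "sf (a N) (v N) = 0"
      using a by (simp add: lessThan_Suc_atMost[symmetric])
    then have "fun_scale (a N) (e 1) = \<psi>1 0"
      using \<psi>1 vF unfolding lie_hom_def by metis
    also have "\<dots> = 0"
      using lie_hom_sum[OF \<psi>1(1) F.lie_algebra_axioms vector_space_fun_scale, of "{}"] by simp
    finally have "fun_scale (a N) (e 1) 1 = 0" by simp
    then have "a N = 0" by (simp add: e_def)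
    then show "\<forall>i\<in>{..N}. a i = 0" using a0 by (auto simp: le_less)
  qed (use span in auto)
  then show False by (simp add: N_def)
qed

section \<open>Matrix coefficients of triple and quadruple brackets\<close>

definition mat_mul :: "(nat \<times> nat \<Rightarrow> 'k::field) \<Rightarrow> (nat \<times> nat \<Rightarrow> 'k) \<Rightarrow> nat \<times> nat \<Rightarrow> 'k" where
  "mat_mul A B = (\<lambda>(i, j). \<Sum>k<5. A (i, k) * B (k, j))"

definition mat_br :: "(nat \<times> nat \<Rightarrow> 'k::field) \<Rightarrow> (nat \<times> nat \<Rightarrow> 'k) \<Rightarrow> nat \<times> nat \<Rightarrow> 'k" where
  "mat_br A B = mat_mul A B - mat_mul B A"

text \<open>Entries outside the 5 by 5 block vanish, which provides the finite support for
  \<open>free_lie_extend_fun\<close>. Size five leaves room for words of length four along the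
  superdiagonal.\<close>

definition upper :: "(nat \<times> nat \<Rightarrow> 'k::field) set" where
  "upper = {A. \<forall>i j. \<not> (i < j \<and> j < 5) \<longrightarrow> A (i, j) = 0}"

lemma mat_mul_assoc: "mat_mul (mat_mul A B) C = mat_mul A (mat_mul B C)"
proof (rule ext)
  fix q :: "nat \<times> nat"
  obtain i j where q: "q = (i, j)" by fastforce
  have "(\<Sum>k<5. \<Sum>l<5. A (i, l) * B (l, k) * C (k, j)) = (\<Sum>l<5. \<Sum>k<5. A (i, l) * B (l, k) * C (k, j))"
    by (rule sum.swap)
  then show "mat_mul (mat_mul A B) C q = mat_mul A (mat_mul B C) q"
    by (simp add: q mat_mul_def sum_distrib_left sum_distrib_right mult.assoc)
qed

lemma mat_mul_add: "mat_mul (A + B) C = mat_mul A C + mat_mul B C" "mat_mul A (B + C) = mat_mul A B + mat_mul A C"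
  by (auto simp: mat_mul_def fun_eq_iff algebra_simps sum.distrib)

lemma mat_mul_diff: "mat_mul (A - B) C = mat_mul A C - mat_mul B C" "mat_mul A (B - C) = mat_mul A B - mat_mul A C"
  by (auto simp: mat_mul_def fun_eq_iff algebra_simps sum_subtractf)

lemma mat_mul_scale: "mat_mul (fun_scale a A) C = fun_scale a (mat_mul A C)"
  "mat_mul A (fun_scale a C) = fun_scale a (mat_mul A C)"
  by (auto simp: mat_mul_def fun_eq_iff sum_distrib_left algebra_simps)

lemma upper_mat_mul: "A \<in> upper \<Longrightarrow> B \<in> upper \<Longrightarrow> mat_mul A B \<in> upper"
  unfolding upper_def mat_mul_def
  by (auto intro!: sum.neutral) (metis less_trans linorder_not_less not_less_iff_gr_or_eq)+

lemma lie_alg_upper: "lie_alg fun_scale upper mat_br"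
proof -
  interpret vector_space fun_scale by (rule vector_space_fun_scale)
  have sub: "subspace upper" by (rule subspaceI) (auto simp: upper_def)
  show ?thesis
    unfolding lie_alg_def
  proof (intro conjI ballI allI vector_space_fun_scale sub)
    fix x y :: "nat \<times> nat \<Rightarrow> 'a" assume "x \<in> upper" "y \<in> upper"
    then show "mat_br x y \<in> upper"
      unfolding mat_br_def by (intro subspace_diff[OF sub] upper_mat_mul)
  qed (simp_all add: mat_br_def mat_mul_add mat_mul_diff mat_mul_scale mat_mul_assoc scale_right_diff_distrib)
qed

lemma upper_br: "A \<in> upper \<Longrightarrow> B \<in> upper \<Longrightarrow> mat_br A B \<in> upper"
  using lie_alg_upper unfolding lie_alg_def by blast

lemma upper_0: "A \<in> upper \<Longrightarrow> j \<le> i \<Longrightarrow> A (i, j) = 0"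
  by (simp add: upper_def)

lemma mat_br_entries:
  assumes "A \<in> upper" "B \<in> upper"
  shows "mat_br A B (0, 1) = 0" "mat_br A B (1, 2) = 0" "mat_br A B (2, 3) = 0" "mat_br A B (3, 4) = 0"
    and "mat_br A B (0, 2) = A (0, 1) * B (1, 2) - B (0, 1) * A (1, 2)"
    and "mat_br A B (1, 3) = A (1, 2) * B (2, 3) - B (1, 2) * A (2, 3)"
    and "mat_br A B (2, 4) = A (2, 3) * B (3, 4) - B (2, 3) * A (3, 4)"
    and "mat_br A B (0, 3) = A (0, 1) * B (1, 3) + A (0, 2) * B (2, 3) - (B (0, 1) * A (1, 3) + B (0, 2) * A (2, 3))"
    and "mat_br A B (1, 4) = A (1, 2) * B (2, 4) + A (1, 3) * B (3, 4) - (B (1, 2) * A (2, 4) + B (1, 3) * A (3, 4))"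
    and "mat_br A B (0, 4) = A (0, 1) * B (1, 4) + A (0, 2) * B (2, 4) + A (0, 3) * B (3, 4)
      - (B (0, 1) * A (1, 4) + B (0, 2) * A (2, 4) + B (0, 3) * A (3, 4))"
proof -
  have 5: "{..<5::nat} = {0, 1, 2, 3, 4}" by auto
  show "mat_br A B (0, 1) = 0" "mat_br A B (1, 2) = 0" "mat_br A B (2, 3) = 0" "mat_br A B (3, 4) = 0"
    "mat_br A B (0, 2) = A (0, 1) * B (1, 2) - B (0, 1) * A (1, 2)"
    "mat_br A B (1, 3) = A (1, 2) * B (2, 3) - B (1, 2) * A (2, 3)"
    "mat_br A B (2, 4) = A (2, 3) * B (3, 4) - B (2, 3) * A (3, 4)"
    "mat_br A B (0, 3) = A (0, 1) * B (1, 3) + A (0, 2) * B (2, 3) - (B (0, 1) * A (1, 3) + B (0, 2) * A (2, 3))"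
    "mat_br A B (1, 4) = A (1, 2) * B (2, 4) + A (1, 3) * B (3, 4) - (B (1, 2) * A (2, 4) + B (1, 3) * A (3, 4))"
    "mat_br A B (0, 4) = A (0, 1) * B (1, 4) + A (0, 2) * B (2, 4) + A (0, 3) * B (3, 4)
      - (B (0, 1) * A (1, 4) + B (0, 2) * A (2, 4) + B (0, 3) * A (3, 4))"
    using assms by (simp_all add: mat_br_def mat_mul_def 5 upper_0)
qed

lemma all_less_numeral: "(\<forall>i<3. P i) \<longleftrightarrow> P 0 \<and> P 1 \<and> P (2::nat)"
  "(\<forall>i<4. P i) \<longleftrightarrow> P 0 \<and> P 1 \<and> P 2 \<and> P (3::nat)"
  by (auto simp: less_Suc_eq numeral_eq_Suc)

section \<open>Functionals on a free presentation of H(1) + A(n - 3)\<close>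

locale free_over_hA =
  fixes sf :: "'k::field \<Rightarrow> 'f::ab_group_add \<Rightarrow> 'f" and bf F X and \<pi> :: "'f \<Rightarrow> nat \<Rightarrow> 'k" and n :: nat
  assumes free: "free_lie_on sf bf F X"
    and inf: "\<And>T. finite T \<Longrightarrow> module.span sf T \<noteq> UNIV"
    and hom: "lie_hom sf bf F hA_scale hA_br (hA_car n) \<pi>"
    and surj: "\<pi> ` F = hA_car n"
    and n3: "3 \<le> n"
begin

sublocale F: lie_algebra sf F bf
  by (rule free_lie_algebra[OF free])

lemma \<pi>_simps [simp]:
  "x \<in> F \<Longrightarrow> y \<in> F \<Longrightarrow> \<pi> (x + y) i = \<pi> x i + \<pi> y i"
  "x \<in> F \<Longrightarrow> \<pi> (sf a x) i = a * \<pi> x i"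
  "x \<in> F \<Longrightarrow> y \<in> F \<Longrightarrow> \<pi> (bf x y) = hA_br (\<pi> x) (\<pi> y)"
  "\<pi> 0 i = 0"
proof -
  show s: "\<pi> (sf a x) i = a * \<pi> x i" if "x \<in> F" for a x i
    using hom that by (simp add: lie_hom_def hA_scale_def)
  show "\<pi> 0 i = 0" using s[of 0 0 i] by simp
qed (use hom in \<open>simp_all add: lie_hom_def\<close>)

text \<open>For a word \<open>p\<close>, the superdiagonal of the image of a generator carries the
  coordinates \<open>p 0\<close> to \<open>p 3\<close>. The entry \<open>\<pi> x 2\<close>, placed
  where the word reads 0, 1, reproduces \<open>[e_0, e_1] = e_2\<close>, so that for suitable words
  the second superdiagonal also depends on \<open>\<pi> x\<close> alone.\<close>

definition mat_lift :: "(nat \<Rightarrow> nat) \<Rightarrow> 'f \<Rightarrow> nat \<times> nat \<Rightarrow> 'k" where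
  "mat_lift p = (SOME \<theta>. lie_hom sf bf F fun_scale mat_br upper \<theta> \<and> (\<forall>x\<in>X. \<theta> x =
     (\<lambda>(i, j). if j = i + 1 \<and> i < 4 then \<pi> x (p i)
       else if j = i + 2 \<and> i < 3 \<and> p i = 0 \<and> p (i + 1) = 1 then \<pi> x 2 else 0)))"

lemma mat_lift:
  "lie_hom sf bf F fun_scale mat_br upper (mat_lift p)"
  "x \<in> X \<Longrightarrow> mat_lift p x = (\<lambda>(i, j). if j = i + 1 \<and> i < 4 then \<pi> x (p i)
       else if j = i + 2 \<and> i < 3 \<and> p i = 0 \<and> p (i + 1) = 1 then \<pi> x 2 else 0)"
proof -
  let ?\<Theta> = "\<lambda>x (i, j). if j = i + 1 \<and> i < 4 then \<pi> x (p i)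
       else if j = i + 2 \<and> i < 3 \<and> p i = 0 \<and> p (i + 1) = 1 then \<pi> x 2 else 0"
  let ?I = "{..<5} \<times> {..<5} :: (nat \<times> nat) set"
  obtain B where B: "finite B" "card B = card ?I" "F.independent B"
    using F.infinite_dimensional_independent[OF inf] by metis
  have "\<exists>\<theta>. lie_hom sf bf F fun_scale mat_br upper \<theta> \<and> (\<forall>x\<in>X. \<theta> x = ?\<Theta> x)"
    by (rule free_lie_extend_fun[OF free lie_alg_upper _ _ B])
      (auto simp: upper_def, meson less_trans)
  from someI_ex[OF this] have
    *: "lie_hom sf bf F fun_scale mat_br upper (mat_lift p) \<and> (\<forall>x\<in>X. mat_lift p x = ?\<Theta> x)"
    unfolding mat_lift_def .
  show "lie_hom sf bf F fun_scale mat_br upper (mat_lift p)" using * by blast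
  show "mat_lift p x = ?\<Theta> x" if "x \<in> X" using * that by blast
qed

lemma mat_lift_simps [simp]:
  "x \<in> F \<Longrightarrow> y \<in> F \<Longrightarrow> mat_lift p (x + y) q = mat_lift p x q + mat_lift p y q"
  "x \<in> F \<Longrightarrow> mat_lift p (sf a x) q = a * mat_lift p x q"
  "x \<in> F \<Longrightarrow> y \<in> F \<Longrightarrow> mat_lift p (bf x y) = mat_br (mat_lift p x) (mat_lift p y)"
  "mat_lift p 0 q = 0"
  "x \<in> F \<Longrightarrow> mat_lift p x \<in> upper"
proof -
  note hom = mat_lift(1)[of p, unfolded lie_hom_def]
  show s: "mat_lift p (sf a x) q = a * mat_lift p x q" if "x \<in> F" for a x q
    using hom that by simp
  show "mat_lift p 0 q = 0" using s[of 0 0 q] by simp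
  show "x \<in> F \<Longrightarrow> mat_lift p x \<in> upper" using hom by blast
qed (use mat_lift(1)[of p, unfolded lie_hom_def] in simp_all)

text \<open>True on generators by construction. A bracket vanishes on the superdiagonal, and its
  image under \<open>\<pi>\<close> vanishes at every coordinate except 2.\<close>

lemma mat_lift_1:
  assumes p: "\<And>i. i < 4 \<Longrightarrow> p i \<noteq> 2" and f: "f \<in> F" and i: "i < 4"
  shows "mat_lift p f (i, i + 1) = \<pi> f (p i)"
proof -
  have "mat_lift p f (0, 1) = \<pi> f (p 0) \<and> mat_lift p f (1, 2) = \<pi> f (p 1) \<and>
    mat_lift p f (2, 3) = \<pi> f (p 2) \<and> mat_lift p f (3, 4) = \<pi> f (p 3)" (is "?P f")
  proof (rule free_lie_induct[OF free f])
    show "F.subspace {x \<in> F. ?P x}"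
      by (rule F.subspaceI) auto
    fix x y assume "x \<in> F" "y \<in> F"
    then show "?P (bf x y)"
      using p[of 0] p[of 1] p[of 2] p[of 3] mat_br_entries(1-4)[of "mat_lift p x" "mat_lift p y"]
      by (simp add: hA_br_def)
  qed (simp add: mat_lift(2))
  then have "\<forall>i<4. mat_lift p f (i, i + 1) = \<pi> f (p i)"
    unfolding all_less_numeral by (simp add: numeral_eq_Suc)
  then show ?thesis using i by blast
qed

lemma mat_lift_superdiag:
  assumes "\<And>i. i < 4 \<Longrightarrow> p i \<noteq> 2" "x \<in> F"
  shows "mat_lift p x (0, 1) = \<pi> x (p 0)" "mat_lift p x (1, 2) = \<pi> x (p 1)"
    "mat_lift p x (2, 3) = \<pi> x (p 2)" "mat_lift p x (3, 4) = \<pi> x (p 3)"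
  using mat_lift_1[of p x 0, OF assms] mat_lift_1[of p x 1, OF assms]
    mat_lift_1[of p x 2, OF assms] mat_lift_1[of p x 3, OF assms]
  by (simp_all add: numeral_eq_Suc)

lemma mat_lift_2:
  assumes p: "\<And>i. i < 3 \<Longrightarrow> (p i, p (i + 1)) \<in> {(0, 0), (0, 1), (1, 1)}" and f: "f \<in> F" and i: "i < 3"
  shows "mat_lift p f (i, i + 2) = (if p i = 0 \<and> p (i + 1) = 1 then \<pi> f 2 else 0)"
proof -
  have p2: "p i \<noteq> 2" if "i < 4" for i using p[of i] p[of "i - 1"] that by (cases "i = 3") auto
  note e1 = mat_lift_superdiag[of p, OF p2]
  have pp: "(p 0, p 1) \<in> {(0, 0), (0, 1), (1, 1)}" "(p 1, p 2) \<in> {(0, 0), (0, 1), (1, 1)}"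
    "(p 2, p 3) \<in> {(0, 0), (0, 1), (1, 1)}"
    using p[of 0] p[of 1] p[of 2] by (simp_all add: numeral_eq_Suc)
  have key: "u q * v r - v q * u r = (if q = 0 \<and> r = 1 then hA_br u v 2 else 0)"
    if "(q, r) \<in> {(0, 0), (0, 1), (1, 1)}" for q r and u v :: "nat \<Rightarrow> 'k"
    using that by (auto simp: hA_br_def mult.commute)
  have "mat_lift p f (0, 2) = (if p 0 = 0 \<and> p 1 = 1 then \<pi> f 2 else 0) \<and>
    mat_lift p f (1, 3) = (if p 1 = 0 \<and> p 2 = 1 then \<pi> f 2 else 0) \<and>
    mat_lift p f (2, 4) = (if p 2 = 0 \<and> p 3 = 1 then \<pi> f 2 else 0)"
    (is "?P f")
  proof (rule free_lie_induct[OF free f])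
    show "F.subspace {x \<in> F. ?P x}"
      by (rule F.subspaceI) auto
    fix x y assume "x \<in> F" "y \<in> F"
    then show "?P (bf x y)"
      by (simp add: mat_br_entries e1 key[OF pp(1)] key[OF pp(2)] key[OF pp(3)] del: One_nat_def)
  qed (simp add: mat_lift(2) numeral_eq_Suc)
  then have "\<forall>i<3. mat_lift p f (i, i + 2) = (if p i = 0 \<and> p (i + 1) = 1 then \<pi> f 2 else 0)"
    unfolding all_less_numeral by (simp add: numeral_eq_Suc)
  then show ?thesis using i by blast
qed

lemma mat_lift_zero_subspace: "F.subspace {x \<in> F. \<forall>q\<in>K. mat_lift p x q = 0}"
  by (rule F.subspaceI) auto

abbreviation "R \<equiv> {x \<in> F. \<pi> x = 0}"

abbreviation "RFF \<equiv> lie_brk sf bf (lie_brk sf bf R F) F"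

text \<open>An element of \<open>R\<close> vanishes on the superdiagonal, and each bracket with
  \<open>F\<close> pushes the first possible nonzero entry one diagonal further.\<close>

lemma mat_lift_RFF_3:
  assumes p: "\<And>i. i < 4 \<Longrightarrow> p i \<noteq> 2" and w: "w \<in> RFF"
  shows "mat_lift p w (0, 3) = 0"
proof -
  let ?K = "{(0, 1), (1, 2), (2, 3), (3, 4), (0, 2), (1, 3), (2, 4)} :: (nat \<times> nat) set"
  have "lie_brk sf bf R F \<subseteq> {x \<in> F. \<forall>q\<in>?K. mat_lift p x q = 0}"
    by (rule F.lie_brk_least[OF mat_lift_zero_subspace])
      (simp add: mat_br_entries mat_lift_superdiag[of p, OF p] del: One_nat_def)
  then have "RFF \<subseteq> {x \<in> F. \<forall>q\<in>{(0, 3)}. mat_lift p x q = 0}"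
    by (intro F.lie_brk_least[OF mat_lift_zero_subspace])
      (auto simp add: mat_br_entries mat_lift_superdiag[of p, OF p] subset_iff simp del: One_nat_def)
  then show ?thesis using w by blast
qed

text \<open>For these words \<open>R\<close> vanishes on two diagonals by \<open>mat_lift_2\<close>,
  so two brackets clear the corner entry as well.\<close>

lemma mat_lift_RFF_4:
  assumes p: "\<And>i. i < 3 \<Longrightarrow> (p i, p (i + 1)) \<in> {(0, 0), (0, 1), (1, 1)}" and w: "w \<in> RFF"
  shows "mat_lift p w (0, 4) = 0"
proof -
  have p2: "p i \<noteq> 2" if "i < 4" for i using p[of i] p[of "i - 1"] that by (cases "i = 3") auto
  let ?K = "{(0, 1), (1, 2), (2, 3), (3, 4), (0, 2), (1, 3), (2, 4)} :: (nat \<times> nat) set"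
  have 2: "mat_lift p r (0, 2) = 0" "mat_lift p r (1, 3) = 0" "mat_lift p r (2, 4) = 0" if "r \<in> R" for r
    using that mat_lift_2[of p r 0, OF p] mat_lift_2[of p r 1, OF p] mat_lift_2[of p r 2, OF p]
    by (simp_all add: numeral_eq_Suc)
  have "lie_brk sf bf R F \<subseteq> {x \<in> F. \<forall>q\<in>?K \<union> {(0, 3), (1, 4)}. mat_lift p x q = 0}"
    by (rule F.lie_brk_least[OF mat_lift_zero_subspace])
      (simp add: mat_br_entries mat_lift_superdiag[of p, OF p2] 2 del: One_nat_def)
  then have "RFF \<subseteq> {x \<in> F. \<forall>q\<in>{(0, 4)}. mat_lift p x q = 0}"
    by (intro F.lie_brk_least[OF mat_lift_zero_subspace])
      (auto simp add: mat_br_entries mat_lift_superdiag[of p, OF p2] subset_iff simp del: One_nat_def)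
  then show ?thesis using w by blast
qed

text \<open>Skips coordinate 2, which spans the derived algebra of the model; the
  \<open>n - 1\<close> remaining coordinates describe its abelianisation.\<close>

definition gen_index :: "nat \<Rightarrow> nat" where
  "gen_index i = (if i < 2 then i else i + 1)"

lemma gen_index_simps [simp]: "gen_index i \<noteq> 2" "gen_index i = gen_index j \<longleftrightarrow> i = j"
  by (auto simp: gen_index_def)

definition gen :: "nat \<Rightarrow> 'f" where
  "gen i = (SOME x. x \<in> F \<and> \<pi> x = (\<lambda>k. if k = gen_index i then 1 else 0))"

lemma gen: "i < n - 1 \<Longrightarrow> gen i \<in> F \<and> \<pi> (gen i) = (\<lambda>k. if k = gen_index i then 1 else 0)"
proof -
  assume "i < n - 1"
  then have "(\<lambda>k. if k = gen_index i then 1 else 0) \<in> \<pi> ` F"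
    unfolding surj by (auto simp: hA_car_def gen_index_def)
  then have "\<exists>x. x \<in> F \<and> \<pi> x = (\<lambda>k. if k = gen_index i then 1 else 0)" by force
  then show ?thesis unfolding gen_def by (rule someI_ex)
qed

text \<open>The summands match the two terms left in \<open>triple_span_bound\<close> for
  \<open>m = 1\<close>: the Hall triples and the three values at the top.\<close>

abbreviation "dual_index \<equiv> hall_triples (n - 1) <+> {(0, 0), (0, 1), (1, 1 :: nat)} :: (nat \<times> nat \<times> nat + nat \<times> nat) set"

fun dual_vec :: "nat \<times> nat \<times> nat + nat \<times> nat \<Rightarrow> 'f" where
  "dual_vec (Inl (i, j, k)) = bf (bf (gen i) (gen j)) (gen k)"
| "dual_vec (Inr (i, j)) = bf (bf (bf (gen 0) (gen 1)) (gen i)) (gen j)"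

text \<open>The words on which the functionals below read off coefficients: \<open>j i k\<close> for the triple
  \<open>(i, j, k)\<close> with \<open>j < k\<close>, \<open>j j i\<close> for \<open>(i, j, j)\<close>, and \<open>0 i j 1\<close> for the quadruple brackets.\<close>

fun dual_word :: "nat \<times> nat \<times> nat + nat \<times> nat \<Rightarrow> nat \<Rightarrow> nat" where
  "dual_word (Inl (i, j, k)) l = gen_index
     (if l = 0 then j else if l = 1 then (if k = j then j else i) else (if k = j then i else k))"
| "dual_word (Inr (i, j)) l = (if l = 0 then 0 else if l = 1 then i else if l = 2 then j else 1)"

fun dual_form :: "nat \<times> nat \<times> nat + nat \<times> nat \<Rightarrow> 'f \<Rightarrow> 'k" where
  "dual_form (Inl t) x = mat_lift (dual_word (Inl t)) x (0, 3)"
| "dual_form (Inr t) x = mat_lift (dual_word (Inr t)) x (0, 4)"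

lemma dual_word_Inl: "dual_word (Inl t) l \<noteq> 2"
  by (cases t) simp

lemma dual_word_Inr:
  "Inr t \<in> dual_index \<Longrightarrow> i < 3 \<Longrightarrow>
    (dual_word (Inr t) i, dual_word (Inr t) (i + 1)) \<in> {(0, 0), (0, 1), (1, 1)}"
  by (auto simp: numeral_eq_Suc less_Suc_eq)

lemma dual_form_RFF: "a \<in> dual_index \<Longrightarrow> w \<in> RFF \<Longrightarrow> dual_form a w = 0"
  by (cases a) (simp_all only: dual_form.simps mat_lift_RFF_3[of "dual_word (Inl t)" for t, OF dual_word_Inl] mat_lift_RFF_4[of "dual_word (Inr t)" for t, OF dual_word_Inr])

lemma dual_vec_F: "b \<in> dual_index \<Longrightarrow> dual_vec b \<in> F"
  using gen n3 by (auto simp: hall_triples_def)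

text \<open>The chosen words occur in their own bracket with coefficient 1 or -1, nonzero in every
  characteristic, and in no other bracket of the family. Triple brackets of the \<open>gen i\<close>
  vanish at \<open>(0, 4)\<close> because the lifts of the \<open>gen i\<close> are zero on the
  second diagonal; quadruple brackets vanish at \<open>(0, 3)\<close>.\<close>

lemma dual_form_vec:
  assumes a: "a \<in> dual_index" and b: "b \<in> dual_index"
  shows "dual_form a (dual_vec b) = 0 \<longleftrightarrow> a \<noteq> b"
proof -
  have g: "gen i \<in> F" "\<pi> (gen i) = (\<lambda>k. if k = gen_index i then 1 else 0)" if "i < n - 1" for i
    using gen that by auto
  have n: "0 < n - 1" "1 < n - 1" using n3 by auto
  have gi: "gen_index 0 = 0" "gen_index 1 = 1" by (simp_all add: gen_index_def)
  show ?thesis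
  proof (cases a)
    case (Inl t)
    let ?p = "dual_word (Inl t)"
    obtain i j k where t: "t = (i, j, k)" by (cases t)
    have ijk: "j < i" "j \<le> k" "i < n - 1" "k < n - 1" using a Inl t by (auto simp: hall_triples_def)
    show ?thesis
    proof (cases b)
      case (Inr q)
      then show ?thesis
        using b Inl g n by (auto simp: mat_br_entries upper_br simp del: One_nat_def)
    next
      case (Inl t')
      obtain i' j' k' where t': "t' = (i', j', k')" by (cases t')
      have ijk': "j' < i'" "j' \<le> k'" "i' < n - 1" "k' < n - 1" "j' < n - 1"
        using b Inl t' by (auto simp: hall_triples_def)
      have "dual_form a (dual_vec b) =
        (of_bool (?p 0 = gen_index i') * of_bool (?p 1 = gen_index j') - of_bool (?p 0 = gen_index j') * of_bool (?p 1 = gen_index i'))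
          * of_bool (?p 2 = gen_index k')
        - of_bool (?p 0 = gen_index k') *
          (of_bool (?p 1 = gen_index i') * of_bool (?p 2 = gen_index j') - of_bool (?p 1 = gen_index j') * of_bool (?p 2 = gen_index i'))"
        using ijk' g unfolding \<open>a = Inl t\<close> Inl t'
        by (simp add: mat_br_entries upper_br mat_lift_superdiag[of ?p, OF dual_word_Inl] of_bool_def
            del: One_nat_def dual_word.simps)
      then show ?thesis
        using ijk ijk' unfolding \<open>a = Inl t\<close> Inl t' t by auto
    qed
  next
    case (Inr q)
    let ?p = "dual_word (Inr q)"
    note w = dual_word_Inr[of q, OF a[unfolded Inr]]
    have w2: "?p l \<noteq> 2" for l using a Inr by (cases q) auto
    have 2: "mat_lift ?p (gen i) (0, 2) = 0" "mat_lift ?p (gen i) (1, 3) = 0" "mat_lift ?p (gen i) (2, 4) = 0"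
      if "i < n - 1" for i
      using g[OF that] mat_lift_2[of ?p "gen i" 0, OF w] mat_lift_2[of ?p "gen i" 1, OF w] mat_lift_2[of ?p "gen i" 2, OF w]
      by (simp_all add: numeral_eq_Suc gen_index_def)
    show ?thesis
    proof (cases b)
      case (Inl t')
      then show ?thesis
        using b Inr g 2 by (auto simp: hall_triples_def mat_br_entries upper_br simp del: One_nat_def dual_word.simps)
    next
      case b': (Inr q')
      have gF: "gen 0 \<in> F" "gen 1 \<in> F" using g n by auto
      note sd = mat_lift_superdiag[of ?p "gen 0", OF w2 gF(1)] mat_lift_superdiag[of ?p "gen 1", OF w2 gF(2)]
      have \<pi>g: "\<pi> (gen 0) = (\<lambda>k. of_bool (k = 0))" "\<pi> (gen 1) = (\<lambda>k. of_bool (k = 1))"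
        using g(2)[OF n(1)] g(2)[OF n(2)] gi by (simp_all add: of_bool_def)
      have "q = (0, 0) \<or> q = (0, 1) \<or> q = (1, 1)" using a Inr by auto
      moreover have "q' = (0, 0) \<or> q' = (0, 1) \<or> q' = (1, 1)" using b b' by auto
      ultimately show ?thesis
        by (elim disjE) (use sd in \<open>simp_all add: Inr b' mat_br_entries upper_br gF \<pi>g del: One_nat_def\<close>)
    qed
  qed
qed

lemma dual_form_linear:
  assumes "finite I" "\<And>i. i \<in> I \<Longrightarrow> v i \<in> F"
  shows "dual_form b (\<Sum>i\<in>I. sf (c i) (v i)) = (\<Sum>i\<in>I. c i * dual_form b (v i))"
  using lie_hom_sum[OF mat_lift(1) F.lie_algebra_axioms vector_space_fun_scale assms]
  by (cases b) (simp_all add: sum_fun_apply)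

text \<open>The model has class two, so every bracket of three elements of \<open>F\<close> lies in
  the kernel of \<open>\<pi>\<close>.\<close>

lemma dual_vec_mult2:
  assumes b: "b \<in> dual_index"
  shows "dual_vec b \<in> R \<inter> lie_pow sf bf F 2"
proof -
  have two: "lie_pow sf bf F 2 = lie_brk sf bf (lie_brk sf bf F F) F"
    by (simp add: numeral_2_eq_2)
  have g: "gen i \<in> F" if "i < n - 1" for i using gen that by blast
  have triple: "bf (bf x y) z \<in> R \<inter> lie_pow sf bf F 2" if "x \<in> F" "y \<in> F" "z \<in> F" for x y z
    using that unfolding two by (auto intro: F.lie_brkI simp: hA_br_def fun_eq_iff)
  show ?thesis
  proof (cases b)
    case (Inl t)
    then obtain i j k where t: "b = Inl (i, j, k)" by (cases t) auto
    then have "i < n - 1" "j < n - 1" "k < n - 1" using b by (auto simp: hall_triples_def)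
    then show ?thesis unfolding t dual_vec.simps by (intro triple g)
  next
    case (Inr t)
    then obtain i j where t: "b = Inr (i, j)" by (cases t) auto
    then have "i < n - 1" "j < n - 1" "0 < n - 1" "1 < n - 1" using b n3 by auto
    then show ?thesis unfolding t dual_vec.simps by (intro triple g F.br_closed)
  qed
qed

text \<open>A relation among the images of the \<open>dual_vec\<close> lifts to a combination in
  \<open>RFF\<close>, which all the forms annihilate; each form isolates one coefficient.\<close>

lemma dim_mult2_ge:
  assumes p: "Vector_Spaces.linear sf sf p" "\<And>x. p x = 0 \<longleftrightarrow> x \<in> RFF"
    and T: "finite T" "p ` (R \<inter> lie_pow sf bf F 2) \<subseteq> F.span T"
  shows "card (hall_triples (n - 1)) + 3 \<le> F.dim (p ` (R \<inter> lie_pow sf bf F 2))"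
proof -
  interpret p: Vector_Spaces.linear sf sf p by (rule p)
  have "card dual_index \<le> F.dim (p ` (R \<inter> lie_pow sf bf F 2))"
  proof (rule F.card_le_dim_family[OF T])
    show fin: "finite dual_index" by simp
    show "(p \<circ> dual_vec) ` dual_index \<subseteq> p ` (R \<inter> lie_pow sf bf F 2)"
      using dual_vec_mult2 unfolding image_comp[symmetric] by blast
    fix c assume "(\<Sum>b\<in>dual_index. sf (c b) ((p \<circ> dual_vec) b)) = 0"
    then have "p (\<Sum>b\<in>dual_index. sf (c b) (dual_vec b)) = 0" by (simp add: p.sum p.scale)
    then have w: "(\<Sum>b\<in>dual_index. sf (c b) (dual_vec b)) \<in> RFF" using p(2) by blast
    show "\<forall>a\<in>dual_index. c a = 0"
    proof
      fix a assume a: "a \<in> dual_index"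
      have "0 = (\<Sum>b\<in>dual_index. c b * dual_form a (dual_vec b))"
        using dual_form_RFF[OF a w] dual_form_linear[OF fin dual_vec_F] by simp
      also have "\<dots> = (\<Sum>b\<in>{a}. c b * dual_form a (dual_vec b))"
        by (rule sum.mono_neutral_right[OF fin]) (use a dual_form_vec[OF a] in auto)
      finally show "c a = 0" using dual_form_vec[OF a a] by simp
    qed
  qed
  then show ?thesis by (simp add: card_Plus)
qed

end

section \<open>The multiplier of a presentation\<close>

lemma (in lie_algebra) C2_complement:
  assumes fd: "fin_dim s C"
  obtains a where "\<And>i. i < dim C - dim (lie_brk s br C C) \<Longrightarrow> a i \<in> C"
    "\<And>x. x \<in> C \<Longrightarrow> \<exists>u \<in> span (a ` {..<dim C - dim (lie_brk s br C C)}). \<exists>w \<in> lie_brk s br C C. x = u + w"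
    "dim (lie_brk s br C C) \<le> dim C"
proof -
  let ?D = "lie_brk s br C C"
  have DC: "?D \<subseteq> C" by (rule lie_brk_subset_C) auto
  obtain T where T: "finite T" "C \<subseteq> span T" using fd unfolding fin_dim_def by blast
  obtain B where B: "B \<subseteq> ?D" "independent B" "?D \<subseteq> span B" "finite B" "card B = dim ?D"
    using extend_to_finite_basis[OF T(1), of ?D "{}"] DC T(2)
    by (metis empty_subsetI independent_empty subset_trans)
  obtain E where E: "B \<subseteq> E" "E \<subseteq> C" "independent E" "C \<subseteq> span E" "finite E" "card E = dim C"
    using extend_to_finite_basis[OF T(1) T(2), of B] B(1,2) DC by (metis subset_trans)
  have le: "dim ?D \<le> dim C" using card_mono[OF E(5,1)] B(5) E(6) by simp
  have "card (E - B) = dim C - dim ?D" using card_Diff_subset[OF B(4) E(1)] B(5) E(6) by simp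
  then obtain a where a: "bij_betw a {0..<dim C - dim ?D} (E - B)"
    using ex_bij_betw_nat_finite[of "E - B"] E(5) by auto
  then have im: "a ` {..<dim C - dim ?D} = E - B" by (simp add: bij_betw_def lessThan_atLeast0)
  show thesis
  proof
    show "a i \<in> C" if "i < dim C - dim ?D" for i using im E(2) that by blast
    show "\<exists>u \<in> span (a ` {..<dim C - dim ?D}). \<exists>w \<in> ?D. x = u + w" if "x \<in> C" for x
    proof -
      have "x \<in> span ((E - B) \<union> B)" using E(1,4) that by (auto simp: Un_absorb2)
      then have "\<exists>u \<in> span (E - B). \<exists>w \<in> span B. x = u + w" unfolding span_Un by blast
      then show ?thesis unfolding im using span_minimal[OF B(1) lie_brk_subspace] by blast
    qed
  qed (rule le)
qed

text \<open>\<open>p\<close> kills a triple bracket as soon as one of its three arguments lies in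
  the kernel of \<open>\<pi>\<close>; for the third slot this uses Jacobi. Hence the value depends
  only on the images in \<open>C\<close>.\<close>

lemma (in lie_algebra) triple_bracket_of_extension:
  fixes sf :: "'k \<Rightarrow> 'f::ab_group_add \<Rightarrow> 'f"
  assumes F: "lie_algebra sf F bf" and hom: "lie_hom sf bf F s br C \<pi>" and surj: "\<pi> ` F = C"
    and p: "Vector_Spaces.linear sf sf p"
    and ker: "\<And>x. p x = 0 \<longleftrightarrow> x \<in> lie_brk sf bf (lie_brk sf bf {x\<in>F. \<pi> x = 0} F) F"
  obtains \<tau> where "triple_bracket s C br sf \<tau>"
    "\<And>x y z. \<lbrakk>x \<in> F; y \<in> F; z \<in> F\<rbrakk> \<Longrightarrow> p (bf (bf x y) z) = \<tau> (\<pi> x) (\<pi> y) (\<pi> z)"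
proof -
  interpret F: lie_algebra sf F bf by (rule F)
  interpret p: Vector_Spaces.linear sf sf p by (rule p)
  let ?R = "{x\<in>F. \<pi> x = 0}"
  let ?W = "lie_brk sf bf (lie_brk sf bf ?R F) F"
  have \<pi>: "\<pi> x \<in> C" "\<pi> (x + y) = \<pi> x + \<pi> y" "\<pi> (bf x y) = br (\<pi> x) (\<pi> y)" "\<pi> (sf a x) = s a (\<pi> x)"
    if "x \<in> F" "y \<in> F" for x y a
    using hom that unfolding lie_hom_def by blast+
  have \<pi>_diff: "\<pi> (x - y) = \<pi> x - \<pi> y" if "x \<in> F" "y \<in> F" for x y
    using \<pi>(2)[of "x - y" y] that by simp
  have r1: "p (bf (bf r y) z) = 0" if "r \<in> ?R" "y \<in> F" "z \<in> F" for r y z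
    using ker F.lie_brkI that by meson
  have r2: "p (bf (bf y r) z) = 0" if "r \<in> ?R" "y \<in> F" "z \<in> F" for r y z
    using r1[OF that] F.br_antisym[of r y] that by (simp add: F.br_neg_left p.neg)
  have r3: "p (bf (bf x y) r) = 0" if "r \<in> ?R" "x \<in> F" "y \<in> F" for r x y
    using r1[of r x y] r1[of r y x] F.br_antisym[of r "bf x y"] F.br_br_right[of r x y] that
    by (simp add: p.neg p.diff)
  have cong: "p (bf (bf x y) z) = p (bf (bf x' y') z')"
    if in_F: "x \<in> F" "y \<in> F" "z \<in> F" "x' \<in> F" "y' \<in> F" "z' \<in> F"
      and eq: "\<pi> x = \<pi> x'" "\<pi> y = \<pi> y'" "\<pi> z = \<pi> z'" for x y z x' y' z'
  proof -
    have R: "x - x' \<in> ?R" "y - y' \<in> ?R" "z - z' \<in> ?R" using in_F eq by (simp_all add: \<pi>_diff)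
    have "p (bf (bf (x - x') y) z) = 0" "p (bf (bf x' (y - y')) z) = 0" "p (bf (bf x' y') (z - z')) = 0"
      using r1[OF R(1)] r2[OF R(2)] r3[OF R(3)] in_F by blast+
    then show ?thesis
      using in_F by (simp add: F.br_diff_left F.br_diff_right p.diff)
  qed
  \<comment> \<open>A pointwise choice of lifts; \<open>cong\<close> makes \<open>\<tau>\<close>
    independent of it.\<close>
  define \<sigma> where "\<sigma> = inv_into F \<pi>"
  have \<sigma>: "\<sigma> u \<in> F" "\<pi> (\<sigma> u) = u" if "u \<in> C" for u
    using that surj inv_into_into[of u \<pi> F] f_inv_into_f[of u \<pi> F] by (auto simp: \<sigma>_def)
  define \<tau> where "\<tau> u v w = p (bf (bf (\<sigma> u) (\<sigma> v)) (\<sigma> w))" for u v w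
  have eq: "p (bf (bf x y) z) = \<tau> (\<pi> x) (\<pi> y) (\<pi> z)" if "x \<in> F" "y \<in> F" "z \<in> F" for x y z
    unfolding \<tau>_def by (rule cong) (use that \<sigma> \<pi>(1) in auto)
  have lift: "\<exists>x\<in>F. u = \<pi> x" if "u \<in> C" for u using surj that by blast
  have "triple_bracket s C br sf \<tau>"
  proof (unfold_locales)
    fix x y z w x' a
    show "\<tau> (x + x') y z = \<tau> x y z + \<tau> x' y z" if "x \<in> C" "x' \<in> C" "y \<in> C" "z \<in> C"
      using that[THEN lift]
      by (elim bexE) (simp add: \<pi>(2)[symmetric] eq[symmetric] F.br_add_left p.add)
    show "\<tau> (s a x) y z = sf a (\<tau> x y z)" if "x \<in> C" "y \<in> C" "z \<in> C"
      using that[THEN lift]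
      by (elim bexE) (simp add: \<pi>(4)[symmetric] eq[symmetric] F.br_scale_left p.scale)
    show "\<tau> x y (z + x') = \<tau> x y z + \<tau> x y x'" if "x \<in> C" "y \<in> C" "z \<in> C" "x' \<in> C"
      using that[THEN lift]
      by (elim bexE) (simp add: \<pi>(2)[symmetric] eq[symmetric] F.br_add_right p.add)
    show "\<tau> x y (s a z) = sf a (\<tau> x y z)" if "x \<in> C" "y \<in> C" "z \<in> C"
      using that[THEN lift]
      by (elim bexE) (simp add: \<pi>(4)[symmetric] eq[symmetric] F.br_scale_right p.scale)
    show "\<tau> y x z = - \<tau> x y z" if "x \<in> C" "y \<in> C" "z \<in> C"
    proof -
      have "bf (\<sigma> y) (\<sigma> x) = - bf (\<sigma> x) (\<sigma> y)" by (rule F.br_antisym) (use \<sigma> that in auto)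
      then show ?thesis using \<sigma> that by (simp add: \<tau>_def F.br_neg_left p.neg)
    qed
    show "\<tau> x x z = 0" if "x \<in> C" "z \<in> C"
      using \<sigma> that by (simp add: \<tau>_def)
    show "\<tau> x y z + \<tau> y z x + \<tau> z x y = 0" if "x \<in> C" "y \<in> C" "z \<in> C"
    proof -
      have *: "\<tau> u v w = - p (bf (\<sigma> w) (bf (\<sigma> u) (\<sigma> v)))" if "u \<in> C" "v \<in> C" "w \<in> C" for u v w
        using \<sigma> that F.br_antisym[of "\<sigma> w" "bf (\<sigma> u) (\<sigma> v)"] by (simp add: \<tau>_def p.neg)
      have "p (bf (\<sigma> x) (bf (\<sigma> y) (\<sigma> z)) + bf (\<sigma> y) (bf (\<sigma> z) (\<sigma> x)) + bf (\<sigma> z) (bf (\<sigma> x) (\<sigma> y))) = 0"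
        using F.jacobi \<sigma> that by simp
      then have "p (bf (\<sigma> x) (bf (\<sigma> y) (\<sigma> z))) + p (bf (\<sigma> y) (bf (\<sigma> z) (\<sigma> x))) + p (bf (\<sigma> z) (bf (\<sigma> x) (\<sigma> y))) = 0"
        by (simp add: p.add)
      then show ?thesis using that by (simp add: * neg_eq_iff_add_eq_0 diff_eq_eq add_ac)
    qed
    show "\<tau> x (br y z) w = \<tau> (br x y) z w - \<tau> (br x z) y w"
      if "x \<in> C" "y \<in> C" "z \<in> C" "w \<in> C"
      using that[THEN lift]
      by (elim bexE) (simp add: \<pi>(3)[symmetric] eq[symmetric] F.br_br_right F.br_diff_left p.diff)
    show "\<tau> x y (br z w) = \<tau> (br x y) z w - \<tau> (br x y) w z"
      if "x \<in> C" "y \<in> C" "z \<in> C" "w \<in> C"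
      using that[THEN lift]
      by (elim bexE) (simp add: \<pi>(3)[symmetric] eq[symmetric] F.br_br_right[of "bf _ _"] p.diff)
    show "\<tau> x y (br x y) = 0" if "x \<in> C" "y \<in> C"
      using that[THEN lift]
      by (elim bexE) (simp add: \<pi>(3)[symmetric] eq[symmetric])
  qed
  then show thesis using that eq by blast
qed

text \<open>With \<open>x = c\<close> and \<open>y = m - 1\<close>, the bound in \<open>n\<close>
  exceeds the bound in \<open>n\<close> and \<open>m\<close> by
  \<open>x * y\<^sup>2 + (y ^ 3 - y) / 3\<close>. This is nonnegative since \<open>y\<close> is a
  natural number, and positive once \<open>x\<close> and \<open>y\<close> are.\<close>

lemma poly_bounds:
  fixes n m c :: nat and H :: nat
  assumes m: "1 \<le> m" "m \<le> n" and c: "c = n - m" and H: "3 * H + c = c ^ 3"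
  shows "real (H + (m - 1) * c\<^sup>2 + 3) = (1/3) * (real n - real m) *
              ((real n + 2 * real m - 2) * (real n - real m - 1) + 3 * (real m - 1)) + 3"
    and "real (H + (m - 1) * c\<^sup>2 + 3) \<le> (1/3) * real n * (real n - 1) * (real n - 2) + 3"
    and "m \<ge> 2 \<Longrightarrow> c \<ge> 1 \<Longrightarrow> real (H + (m - 1) * c\<^sup>2 + 3) < (1/3) * real n * (real n - 1) * (real n - 2) + 3"
proof -
  obtain k where k: "m = Suc k" using m by (cases m) auto
  define x y where "x = real c" and "y = real k"
  have nm: "real n = x + y + 1" "real m = y + 1" using m c k by (simp_all add: x_def y_def)
  have nn: "0 \<le> x" "0 \<le> y" by (simp_all add: x_def y_def)
  have "3 * real H + x = x ^ 3" using H unfolding x_def by (metis of_nat_add of_nat_mult of_nat_numeral of_nat_power)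
  then have H': "real H = (x ^ 3 - x) / 3" by simp
  have lhs: "real (H + (m - 1) * c\<^sup>2 + 3) = (x ^ 3 - x) / 3 + y * x\<^sup>2 + 3"
    by (simp add: k H' x_def[symmetric] y_def[symmetric])
  show "real (H + (m - 1) * c\<^sup>2 + 3) = (1/3) * (real n - real m) *
              ((real n + 2 * real m - 2) * (real n - real m - 1) + 3 * (real m - 1)) + 3"
    unfolding lhs nm by (simp add: field_simps power2_eq_square power3_eq_cube)
  have diff: "(1/3) * real n * (real n - 1) * (real n - 2) + 3 =
      (x ^ 3 - x) / 3 + y * x\<^sup>2 + 3 + (x * y\<^sup>2 + (y ^ 3 - y) / 3)"
    unfolding nm by (simp add: field_simps power2_eq_square power3_eq_cube)
  have "k \<le> k ^ 3" using self_le_power[of k 3] by (cases "k = 0") auto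
  then have "y \<le> y ^ 3" unfolding y_def by (metis of_nat_le_iff of_nat_power)
  then show "real (H + (m - 1) * c\<^sup>2 + 3) \<le> (1/3) * real n * (real n - 1) * (real n - 2) + 3"
    unfolding lhs diff using nn by simp
  assume "m \<ge> 2" "c \<ge> 1"
  then have "x * y\<^sup>2 > 0" by (simp add: x_def y_def k)
  then show "real (H + (m - 1) * c\<^sup>2 + 3) < (1/3) * real n * (real n - 1) * (real n - 2) + 3"
    unfolding lhs diff using add_pos_nonneg[of "x * y\<^sup>2" "(y ^ 3 - y) / 3"] \<open>y \<le> y ^ 3\<close> by simp
qed

text \<open>A free Lie algebra on at most one generator lies on a line and is abelian.\<close>

lemma free_lie_two_generators:
  assumes free: "free_lie_on s br F X" and xy: "x \<in> F" "y \<in> F" "br x y \<noteq> 0"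
  shows "\<exists>a\<in>X. \<exists>b\<in>X. a \<noteq> b"
proof (rule ccontr)
  interpret lie_algebra s F br by (rule free_lie_algebra[OF free])
  assume "\<not> ?thesis"
  moreover have "X \<subseteq> F" using free by (simp add: free_lie_on_def)
  \<comment> \<open>For empty \<open>X\<close> the element 0 serves as \<open>g\<close>.\<close>
  ultimately obtain g where g: "g \<in> F" "\<And>x. x \<in> X \<Longrightarrow> x = g"
    by (metis C_0 subsetD)
  have span: "z \<in> span {g}" if "z \<in> F" for z
  proof (rule free_lie_induct[OF free that])
    have "{x \<in> F. x \<in> span {g}} = F \<inter> span {g}" by blast
    then show "subspace {x \<in> F. x \<in> span {g}}" by (simp add: subspace_inter C_subspace)
    show "x \<in> span {g}" if "x \<in> X" for x using g(2)[OF that] by (auto intro: span_base)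
    fix u v assume "u \<in> span {g}" "v \<in> span {g}"
    then show "br u v \<in> span {g}"
      using g(1) by (auto simp: span_singleton br_scale_left br_scale_right span_zero intro: exI[of _ 0])
  qed
  obtain a b where "x = s a g" "y = s b g" using span xy(1,2) unfolding span_singleton by blast
  then show False using xy(3) g(1) by (simp add: br_scale_left br_scale_right)
qed

theorem theorem2p14:
  fixes sl :: "'k::field \<Rightarrow> 'l::ab_group_add \<Rightarrow> 'l" and bl :: "'l \<Rightarrow> 'l \<Rightarrow> 'l" and L :: "'l set"
    and sf :: "'k \<Rightarrow> 'f::ab_group_add \<Rightarrow> 'f" and bf :: "'f \<Rightarrow> 'f \<Rightarrow> 'f" and F X :: "'f set"
    and \<pi> :: "'f \<Rightarrow> 'l" and n m :: nat
  assumes L: "lie_alg sl L bl" and fd: "fin_dim sl L" and nil: "lie_nilpotent sl L bl"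
    and n: "vector_space.dim sl L = n"
    and m: "vector_space.dim sl (lie_pow sl bl L 1) = m" and m1: "m \<ge> 1"
    and free: "free_lie_on sf bf F X"
    and hom: "lie_hom sf bf F sl bl L \<pi>" and surj: "\<pi> ` F = L"
  shows "\<exists>d. mult2_dim sf bf F {x\<in>F. \<pi> x = 0} = enat d \<and>
    real d \<le> (1/3) * (real n - real m) *
              ((real n + 2 * real m - 2) * (real n - real m - 1) + 3 * (real m - 1)) + 3 \<and>
    real d \<le> (1/3) * real n * (real n - 1) * (real n - 2) + 3 \<and>
    (real d = (1/3) * real n * (real n - 1) * (real n - 2) + 3 \<longleftrightarrow> iso_H1_plus_A sl bl L n)"
proof -
  interpret L: lie_algebra sl L bl by unfold_locales (rule L)
  interpret F: lie_algebra sf F bf by (rule free_lie_algebra[OF free])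
  define R where "R = {x\<in>F. \<pi> x = 0}"
  define W where "W = lie_brk sf bf (lie_brk sf bf R F) F"
  define U where "U = R \<inter> lie_pow sf bf F 2"
  define c where "c = n - m"
  have m': "L.dim (lie_brk sl bl L L) = m" using m by simp
  obtain p where p: "Vector_Spaces.linear sf sf p" "\<And>x. p x = 0 \<longleftrightarrow> x \<in> W"
    using F.kernel_projection[OF F.lie_brk_subspace] unfolding W_def by blast
  interpret p: Vector_Spaces.linear sf sf p by (rule p(1))
  obtain \<tau> where \<tau>: "triple_bracket sl L bl sf \<tau>"
    "\<And>x y z. \<lbrakk>x \<in> F; y \<in> F; z \<in> F\<rbrakk> \<Longrightarrow> p (bf (bf x y) z) = \<tau> (\<pi> x) (\<pi> y) (\<pi> z)"
    using L.triple_bracket_of_extension[OF F.lie_algebra_axioms hom surj p(1)] p(2)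
    unfolding W_def R_def by blast
  interpret T: triple_bracket sl L bl sf \<tau> by (rule \<tau>(1))
  obtain a where a: "\<And>i. i < c \<Longrightarrow> a i \<in> L"
    "\<And>x. x \<in> L \<Longrightarrow> \<exists>u \<in> L.span (a ` {..<c}). \<exists>w \<in> lie_brk sl bl L L. x = u + w" "m \<le> n"
    using L.C2_complement[OF fd] unfolding m' n c_def by metis
  interpret T: triple_bracket_nilpotent sl L bl sf \<tau> a c
    by unfold_locales (use fd nil a in auto)
  \<comment> \<open>The third term of the lower central series is spanned by triple brackets, and
    \<open>p\<close> maps these to values of \<open>\<tau>\<close>.\<close>
  have image_span: "p ` U \<subseteq> F.span T"
    if T: "\<And>x y z. \<lbrakk>x \<in> L; y \<in> L; z \<in> L\<rbrakk> \<Longrightarrow> \<tau> x y z \<in> F.span T" for T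
  proof -
    have \<pi>L: "\<pi> x \<in> L" if "x \<in> F" for x using surj that by blast
    have "F.subspace {x \<in> F. \<forall>y\<in>F. p (bf x y) \<in> F.span T}"
      by (rule F.subspaceI)
        (auto simp: F.br_add_left F.br_scale_left p.add p.scale F.span_add F.span_scale F.span_zero)
    then have "lie_brk sf bf F F \<subseteq> {x \<in> F. \<forall>y\<in>F. p (bf x y) \<in> F.span T}"
      by (rule F.lie_brk_least) (use \<tau>(2) T \<pi>L in auto)
    then have "lie_brk sf bf (lie_brk sf bf F F) F \<subseteq> {x. p x \<in> F.span T}"
      by (intro F.lie_brk_least p.subspace_linear_preimage) auto
    then show ?thesis unfolding U_def by (auto simp: numeral_2_eq_2)
  qed
  define d where "d = F.dim (p ` U)"
  obtain T where T: "finite T" "card T \<le> card (hall_triples c) + (m - 1) * c\<^sup>2 + 3"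
    "\<And>x y z. \<lbrakk>x \<in> L; y \<in> L; z \<in> L\<rbrakk> \<Longrightarrow> \<tau> x y z \<in> F.span T"
    using T.triple_span_bound[OF m' m1] by blast
  note H = card_hall_triples[of c]
  note bounds = poly_bounds[OF m1 a(3) c_def H]
  have d: "mult2_dim sf bf F {x\<in>F. \<pi> x = 0} = enat d"
    unfolding mult2_dim_def d_def R_def[symmetric] U_def[symmetric] W_def[symmetric]
    by (rule F.quot_dim_eq_dim_image[OF p T(1) image_span[OF T(3)]])
  have "d \<le> card T" unfolding d_def by (rule F.dim_le_card[OF image_span[OF T(3)] T(1)])
  then have d_le: "real d \<le> real (card (hall_triples c) + (m - 1) * c\<^sup>2 + 3)" using T(2) by linarith
  let ?g = "(1/3) * real n * (real n - 1) * (real n - 2) + 3"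
  have d_g: "real d \<le> ?g" using d_le bounds(2) by linarith
  have "iso_H1_plus_A sl bl L n" if eq: "real d = ?g"
  proof -
    \<comment> \<open>Otherwise \<open>L\<close> equals its derived algebra, which is impossible for
      a nonzero nilpotent algebra.\<close>
    have "c \<ge> 1"
    proof (rule ccontr)
      assume "\<not> c \<ge> 1"
      then have "c = 0" by simp
      then have "L.span (a ` {..<c}) = {0}" by simp
      then have LD: "L \<subseteq> lie_brk sl bl L L" using a(2) by fastforce
      have "L.dim L = Suc (n - 1)" using n m1 a(3) by simp
      then obtain v K' where "v \<in> L" "v \<notin> K'" "lie_brk sl bl L L \<subseteq> K'"
        using L.ideal_hyperplane[OF fd nil L.C_subspace subset_refl T.C2_C] by metis
      then show False using LD by blast
    qed
    have "m = 1" using bounds(3) d_le eq m1 \<open>c \<ge> 1\<close> by linarith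
    then have "L.dim (lie_brk sl bl L L) = 1" using m' by simp
    then show ?thesis
    proof (cases rule: T.triple_span_bound_or_iso)
      case 1
      then show ?thesis using n by simp
    next
      case (2 T')
      \<comment> \<open>The three extra brackets are absent here, so \<open>d\<close> stays at least
        3 below the bound.\<close>
      have "d \<le> card T'" unfolding d_def by (rule F.dim_le_card[OF image_span[OF 2(3)] 2(1)])
      then have "real d < real (card (hall_triples c) + (m - 1) * c\<^sup>2 + 3)" using 2(2) by linarith
      then show ?thesis using bounds(2) eq by linarith
    qed
  qed
  moreover have "real d = ?g" if iso: "iso_H1_plus_A sl bl L n"
  proof -
    obtain f :: "'l \<Rightarrow> nat \<Rightarrow> 'k" where n3: "3 \<le> n" and f: "lie_iso sl bl L hA_scale hA_br (hA_car n) f"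
      using iso unfolding iso_H1_plus_A_def by blast
    have f_hom: "lie_hom sl bl L hA_scale hA_br (hA_car n) f" and f_bij: "bij_betw f L (hA_car n)"
      using f unfolding lie_iso_def by blast+
    have \<pi>f: "lie_hom sf bf F hA_scale hA_br (hA_car n) (f \<circ> \<pi>)"
      using hom f_hom unfolding lie_hom_def by (auto simp: image_subset_iff)
    have "f 0 = hA_scale 0 (f 0)" using f_hom L.C_0 unfolding lie_hom_def by (metis L.scale_zero_left)
    then have f0: "f 0 = 0" by (simp add: hA_scale_def fun_eq_iff)
    \<comment> \<open>Composing with the isomorphism \<open>f\<close> leaves the kernel, and hence
      the multiplier, unchanged.\<close>
    have R: "{x\<in>F. (f \<circ> \<pi>) x = 0} = R"
    proof -
      have "f (\<pi> x) = 0 \<longleftrightarrow> \<pi> x = 0" if "x \<in> F" for x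
        using that surj f0 f_bij L.C_0 by (metis bij_betw_imp_inj_on imageI inj_on_eq_iff)
      then show ?thesis unfolding R_def by auto
    qed
    \<comment> \<open>\<open>L\<close> is not abelian because \<open>m \<ge> 1\<close>, so neither
      is \<open>F\<close>. This yields two generators and with them an infinite-dimensional ambient
      space.\<close>
    have "\<exists>x\<in>F. \<exists>y\<in>F. bf x y \<noteq> 0"
    proof (rule ccontr)
      assume "\<not> ?thesis"
      then have zero: "bf x y = 0" if "x \<in> F" "y \<in> F" for x y using that by blast
      have \<pi>0: "\<pi> 0 = 0" using hom F.C_0 unfolding lie_hom_def by (metis F.scale_zero_left L.scale_zero_left)
      have "bl (\<pi> x) (\<pi> y) = 0" if "x \<in> F" "y \<in> F" for x y
        using hom zero[OF that] that \<pi>0 unfolding lie_hom_def by metis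
      then have "lie_brk sl bl L L \<subseteq> L.span {}"
        using surj by (intro L.lie_brk_least) auto
      then show False using L.dim_le_card[of "lie_brk sl bl L L" "{}"] m' m1 by simp
    qed
    then obtain x y where xy: "x \<in> X" "y \<in> X" "x \<noteq> y" using free_lie_two_generators[OF free] by blast
    interpret A: free_over_hA sf bf F X "f \<circ> \<pi>" n
    proof
      show "free_lie_on sf bf F X" by (rule free)
      show "F.span T \<noteq> UNIV" if "finite T" for T
        by (rule free_lie_infinite_dimensional[OF free xy that])
      show "(f \<circ> \<pi>) ` F = hA_car n"
        unfolding image_comp[symmetric] surj using f_bij by (simp add: bij_betw_def)
    qed (use \<pi>f n3 in auto)
    have "card (hall_triples (n - 1)) + 3 \<le> d"
      unfolding d_def U_def
      using A.dim_mult2_ge[OF p(1) _ T(1)] image_span[OF T(3)] p(2) unfolding R W_def U_def by blast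
    moreover have "real (card (hall_triples (n - 1)) + 3) = ?g"
    proof -
      \<comment> \<open>At \<open>m = 1\<close> the bound in \<open>n\<close> and \<open>m\<close>
        coincides with the bound in \<open>n\<close>.\<close>
      have "real (card (hall_triples (n - 1)) + (1 - 1) * (n - 1)\<^sup>2 + 3) = (1/3) * (real n - real 1) *
          ((real n + 2 * real 1 - 2) * (real n - real 1 - 1) + 3 * (real 1 - 1)) + 3"
        by (rule poly_bounds(1)[OF _ _ refl card_hall_triples]) (use n3 in auto)
      also have "\<dots> = ?g" by (simp add: field_simps)
      finally show ?thesis by simp
    qed
    ultimately have "?g \<le> real d" by linarith
    then show ?thesis using d_g by linarith
  qed
  ultimately have "real d = ?g \<longleftrightarrow> iso_H1_plus_A sl bl L n" by blast
  then show ?thesis using d d_le[unfolded bounds(1)] d_g by (intro exI[of _ d] conjI)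
qed

end
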